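(* For every $m\in\{2,\dots,n\}$, $$\mathrm{Gap}(m,m-1)\ \ge\ 1-S(m).$$ As a result, for every $l\in\{1,\dots,n-1\}$, $$\mathrm{Gap}(n,l)\ \ge\ \prod_{m=l+1}^n[1-S(m)].$$
   Context: Setting. Let $n\ge 2$ be an integer, $[n]=\{1,\dots,n\}$, and let $(\mathsf{X}_i,\mathcal{B}_i,\mu_i)$, $i\in[n]$, be $\sigma$-finite measure spaces in which singletons are measurable. Let $\mathbf{X}=(X_1,\dots,X_n)$ be a random element, $X_i$ taking values in $\mathsf{X}_i$, whose joint distribution $\Pi$ on $\mathsf{X}=\mathsf{X}_1\times\dots\times\mathsf{X}_n$ has density $\pi$ with respect to $\mu_1\times\dots\times\mu_n$; $\pi$ is a measurable function specified everywhere on $\mathsf{X}$. For $\Gamma\subset[n]$ write $-\Gamma=[n]\setminus\Gamma$; for nonempty $\Gamma$ let $\mathsf{X}_\Gamma=\prod_{i\in\Gamma}\mathsf{X}_i$, $\mu_\Gamma=\prod_{i\in\Gamma}\mu_i$, and let $\mathbf{X}_\Gamma$, $\mathbf{x}_\Gamma$ denote the subvectors of $\mathbf{X}$, $\mathbf{x}\in\mathsf{X}$ with indices in $\Gamma$ (in increasing order). The marginal density of $\mathbf{X}_\Gamma$ is $\pi_\Gamma(\mathbf{y})=\int_{\mathsf{X}_{-\Gamma}}\pi(\mathbf{x})\,\mu_{-\Gamma}(d\mathbf{x}_{-\Gamma})$ with $\mathbf{x}_\Gamma=\mathbf{y}$, and $\pi_{[n]}=\pi$. For disjoint nonempty $\Lambda,\Gamma\subset[n]$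 and $\mathbf{y}\in\mathsf{X}_\Lambda$ with $\pi_\Lambda(\mathbf{y})>0$, the conditional density is $\pi_{\Gamma\mid\Lambda}(\mathbf{z}\mid\mathbf{y})=\pi_{\Lambda\cup\Gamma}(\mathbf{x}_{\Lambda\cup\Gamma})/\pi_\Lambda(\mathbf{y})$ where $\mathbf{x}_\Lambda=\mathbf{y}$, $\mathbf{x}_\Gamma=\mathbf{z}$; if $\pi_\Lambda(\mathbf{y})=0$, $\pi_{\Gamma\mid\Lambda}(\cdot\mid\mathbf{y})$ is an arbitrary probability density on $\mathsf{X}_\Gamma$. If $\Lambda=\emptyset$, $\pi_{\Gamma\mid\Lambda}(\cdot\mid\mathbf{y})$ means $\pi_\Gamma(\cdot)$ (and conditions on $\mathbf{y}$, such as $\pi_\Lambda(\mathbf{y})>0$, are vacuous). Spectral gap. For a probability measure $\nu$, $L_0^2(\nu)$ is the Hilbert space of real square-integrable functions with $\int f\,d\nu=0$, with norm $\|\cdot\|_\nu$. A Markov kernel $K$ reversible with respect to $\nu$ acts on $L_0^2(\nu)$ by $Kf(x)=\int f(x')K(x,dx')$; $\|K\|_\nu=\sup_{f\in L_0^2(\nu),f\ne0}\|Kf\|_\nu/\|f\|_\nu$, and the spectral gap of $K$ is $1-\|K\|_\nu$. Gibbs samplers. For $\Lambda\subset[n]$ with $|\Lambda|\le n-1$, $\mathbf{y}\in\mathsf{X}_\Lambda$ and $l\in\{1,\dots,n-|\Lambda|\}$, the random-scan Gibbs sampler targeting $\pi_{-\Lambda\mid\Lambda}(\cdot\mid\mathbf{y})$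 with block size $l$ is the Markov chain on $\mathsf{X}_{-\Lambda}$ that moves from $\mathbf{z}$ as follows: let $\mathbf{x}$ satisfy $\mathbf{x}_\Lambda=\mathbf{y}$, $\mathbf{x}_{-\Lambda}=\mathbf{z}$; choose $\Gamma\subset-\Lambda$ with $|\Gamma|=l$ uniformly at random; draw $\mathbf{w}\in\mathsf{X}_\Gamma$ from $\pi_{\Gamma\mid-\Gamma}(\cdot\mid\mathbf{x}_{-\Gamma})$; let $\mathbf{x}'_\Gamma=\mathbf{w}$, $\mathbf{x}'_{-\Gamma}=\mathbf{x}_{-\Gamma}$; the new state is $\mathbf{x}'_{-\Lambda}$. When $\pi_\Lambda(\mathbf{y})>0$ this chain is reversible with respect to $\pi_{-\Lambda\mid\Lambda}(\cdot\mid\mathbf{y})$; let $\mathrm{gap}(\Lambda,\mathbf{y},l)$ be its spectral gap. For $l\in\{1,\dots,n\}$ and $m\in\{l,\dots,n\}$, $$\mathrm{Gap}(m,l)=\min_{\Lambda\subset[n],\,|\Lambda|=n-m}\ \inf_{\mathbf{y}\in\mathsf{X}_\Lambda,\ \pi_\Lambda(\mathbf{y})>0}\mathrm{gap}(\Lambda,\mathbf{y},l).$$ In particular $\mathrm{Gap}(n,l)$ is the spectral gap of the Gibbs sampler targeting $\pi$ with block size $l$. Correlation coefficients. For random elements $Y_1,\dots,Y_m$ (with a joint distribution on a product space) with marginal distributions $\varpi_1,\dots,\varpi_m$, define $$s_*(Y_1,\dots,Y_m)=\sup\frac{\mathbb{E}\{[\sum_{i=1}^m f_i(Y_i)]^2\}}{m\sum_{i=1}^m\mathbb{E}[f_i(Y_i)^2]},$$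 the supremum being over all $(f_1,\dots,f_m)$ with $f_i\in L_0^2(\varpi_i)$ for all $i$ and $\mathbb{E}[f_i(Y_i)^2]>0$ for some $i$. For $\Lambda\subset[n]$ with $|\Lambda|\le n-1$ and $\mathbf{y}\in\mathsf{X}_\Lambda$, let $s(\Lambda,\mathbf{y})=s_*(Y_1,\dots,Y_{n-|\Lambda|})$, where $(Y_1,\dots,Y_{n-|\Lambda|})$ is distributed according to $\pi_{-\Lambda\mid\Lambda}(\cdot\mid\mathbf{y})$. For $m\in\{2,\dots,n\}$, $S(m)=\max_{\Lambda\subset[n],|\Lambda|=n-m}\ \sup_{\mathbf{y}\in\mathsf{X}_\Lambda,\,\pi_\Lambda(\mathbf{y})>0}s(\Lambda,\mathbf{y})$. *)

theory Defs
  imports "HOL-Probability.Probability"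
begin

section \<open>Spectral gap of a Markov kernel\<close>

definition L20 :: "'b measure \<Rightarrow> ('b \<Rightarrow> real) set" where
  "L20 \<nu> = {f \<in> borel_measurable \<nu>. integrable \<nu> (\<lambda>x. (f x)\<^sup>2) \<and> (LINT x|\<nu>. f x) = 0}"

definition norm_L2 :: "'b measure \<Rightarrow> ('b \<Rightarrow> real) \<Rightarrow> real" where
  "norm_L2 \<nu> f = sqrt (LINT x|\<nu>. (f x)\<^sup>2)"

definition kernel_op :: "('b \<Rightarrow> 'b measure) \<Rightarrow> ('b \<Rightarrow> real) \<Rightarrow> 'b \<Rightarrow> real" where
  "kernel_op K f x = (LINT x'|K x. f x')"

text \<open>The ratios are nonnegative; inserting \<open>0\<close> only fixes the supremum to be \<open>0\<close>
  when \<open>L20 \<nu>\<close> has no nonzero element.\<close>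

definition kernel_norm :: "'b measure \<Rightarrow> ('b \<Rightarrow> 'b measure) \<Rightarrow> ereal" where
  "kernel_norm \<nu> K = Sup (insert 0
     {ereal (norm_L2 \<nu> (kernel_op K f) / norm_L2 \<nu> f) | f. f \<in> L20 \<nu> \<and> norm_L2 \<nu> f \<noteq> 0})"

definition spectral_gap :: "'b measure \<Rightarrow> ('b \<Rightarrow> 'b measure) \<Rightarrow> ereal" where
  "spectral_gap \<nu> K = 1 - kernel_norm \<nu> K"

section \<open>Marginal and conditional densities\<close>

text \<open>The coordinate spaces are \<open>M 1, \<dots>, M n\<close>, and \<open>p\<close> is a joint density with respect to
  \<open>Pi\<^sub>M {1..n} M\<close>.  Subvectors with indices in \<open>\<Gamma>\<close> are elements of \<open>space (Pi\<^sub>M \<Gamma> M)\<close>.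
  The marginal density is a Bochner integral, hence \<open>0\<close> at the points (forming a null set) where
  the integral diverges; such points are thus treated as points of zero density.
  For \<open>\<Gamma> = {}\<close> the marginal is the total mass \<open>1\<close>, for \<open>\<Gamma> = {1..n}\<close> it is \<open>p\<close>.\<close>

definition marginal ::
  "nat \<Rightarrow> (nat \<Rightarrow> 'a measure) \<Rightarrow> ((nat \<Rightarrow> 'a) \<Rightarrow> real) \<Rightarrow> nat set \<Rightarrow> (nat \<Rightarrow> 'a) \<Rightarrow> real" where
  "marginal n M p \<Gamma> y =
     (LINT z|Pi\<^sub>M ({1..n} - \<Gamma>) M. p (merge \<Gamma> ({1..n} - \<Gamma>) (y, z)))"

definition prob_density :: "'b measure \<Rightarrow> ('b \<Rightarrow> real) \<Rightarrow> bool" where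
  "prob_density N f \<longleftrightarrow> f \<in> borel_measurable N \<and> (\<forall>x\<in>space N. 0 \<le> f x) \<and>
     prob_space (density N (\<lambda>x. ennreal (f x)))"

text \<open>\<open>cond_densities n M p c\<close>: the function \<open>c \<Gamma> \<Lambda> z y\<close> is a choice of the
  conditional densities of the coordinates \<open>\<Gamma>\<close> at \<open>z\<close> given the coordinates \<open>\<Lambda>\<close> at \<open>y\<close>.  It is
  arbitrary where the marginal density of \<open>y\<close> vanishes, except for the joint measurability that
  is needed for the Gibbs samplers below to be Markov kernels.  For \<open>\<Lambda> = {}\<close> the marginal in the
  denominator is \<open>1\<close>, so that \<open>c \<Gamma> {} z y\<close> is the marginal density of \<open>\<Gamma>\<close>.\<close>

definition cond_densities ::
  "nat \<Rightarrow> (nat \<Rightarrow> 'a measure) \<Rightarrow> ((nat \<Rightarrow> 'a) \<Rightarrow> real) \<Rightarrow>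
   (nat set \<Rightarrow> nat set \<Rightarrow> (nat \<Rightarrow> 'a) \<Rightarrow> (nat \<Rightarrow> 'a) \<Rightarrow> real) \<Rightarrow> bool" where
  "cond_densities n M p c \<longleftrightarrow>
     (\<forall>\<Gamma> \<Lambda>. \<Gamma> \<subseteq> {1..n} \<and> \<Lambda> \<subseteq> {1..n} \<and> \<Gamma> \<inter> \<Lambda> = {} \<and> \<Gamma> \<noteq> {} \<longrightarrow>
       (\<lambda>(y, z). c \<Gamma> \<Lambda> z y) \<in> borel_measurable (Pi\<^sub>M \<Lambda> M \<Otimes>\<^sub>M Pi\<^sub>M \<Gamma> M) \<and>
       (\<forall>y\<in>space (Pi\<^sub>M \<Lambda> M).
          if 0 < marginal n M p \<Lambda> y
          then \<forall>z\<in>space (Pi\<^sub>M \<Gamma> M).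
                 c \<Gamma> \<Lambda> z y = marginal n M p (\<Lambda> \<union> \<Gamma>) (merge \<Lambda> \<Gamma> (y, z)) / marginal n M p \<Lambda> y
          else prob_density (Pi\<^sub>M \<Gamma> M) (\<lambda>z. c \<Gamma> \<Lambda> z y)))"

definition cond_dist ::
  "(nat \<Rightarrow> 'a measure) \<Rightarrow> (nat set \<Rightarrow> nat set \<Rightarrow> (nat \<Rightarrow> 'a) \<Rightarrow> (nat \<Rightarrow> 'a) \<Rightarrow> real) \<Rightarrow>
   nat set \<Rightarrow> nat set \<Rightarrow> (nat \<Rightarrow> 'a) \<Rightarrow> (nat \<Rightarrow> 'a) measure" where
  "cond_dist M c \<Gamma> \<Lambda> y = density (Pi\<^sub>M \<Gamma> M) (\<lambda>z. ennreal (c \<Gamma> \<Lambda> z y))"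

section \<open>Random-scan Gibbs samplers\<close>

definition gibbs_kernel ::
  "nat \<Rightarrow> (nat \<Rightarrow> 'a measure) \<Rightarrow> (nat set \<Rightarrow> nat set \<Rightarrow> (nat \<Rightarrow> 'a) \<Rightarrow> (nat \<Rightarrow> 'a) \<Rightarrow> real) \<Rightarrow>
   nat set \<Rightarrow> (nat \<Rightarrow> 'a) \<Rightarrow> nat \<Rightarrow> (nat \<Rightarrow> 'a) \<Rightarrow> (nat \<Rightarrow> 'a) measure" where
  "gibbs_kernel n M c \<Lambda> y l z =
     (let x = merge \<Lambda> ({1..n} - \<Lambda>) (y, z) in
      uniform_count_measure {\<Gamma>. \<Gamma> \<subseteq> {1..n} - \<Lambda> \<and> card \<Gamma> = l} \<bind>
        (\<lambda>\<Gamma>. distr (cond_dist M c \<Gamma> ({1..n} - \<Gamma>) (restrict x ({1..n} - \<Gamma>)))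
                (Pi\<^sub>M ({1..n} - \<Lambda>) M)
                (\<lambda>w. restrict (merge \<Gamma> ({1..n} - \<Gamma>) (w, x)) ({1..n} - \<Lambda>))))"

definition gibbs_gap ::
  "nat \<Rightarrow> (nat \<Rightarrow> 'a measure) \<Rightarrow> (nat set \<Rightarrow> nat set \<Rightarrow> (nat \<Rightarrow> 'a) \<Rightarrow> (nat \<Rightarrow> 'a) \<Rightarrow> real) \<Rightarrow>
   nat set \<Rightarrow> (nat \<Rightarrow> 'a) \<Rightarrow> nat \<Rightarrow> ereal" where
  "gibbs_gap n M c \<Lambda> y l =
     spectral_gap (cond_dist M c ({1..n} - \<Lambda>) \<Lambda> y) (gibbs_kernel n M c \<Lambda> y l)"

definition Gap ::
  "nat \<Rightarrow> (nat \<Rightarrow> 'a measure) \<Rightarrow> ((nat \<Rightarrow> 'a) \<Rightarrow> real) \<Rightarrow>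
   (nat set \<Rightarrow> nat set \<Rightarrow> (nat \<Rightarrow> 'a) \<Rightarrow> (nat \<Rightarrow> 'a) \<Rightarrow> real) \<Rightarrow> nat \<Rightarrow> nat \<Rightarrow> ereal" where
  "Gap n M p c m l =
     (MIN \<Lambda>\<in>{\<Lambda>. \<Lambda> \<subseteq> {1..n} \<and> card \<Lambda> = n - m}.
        INF y\<in>{y \<in> space (Pi\<^sub>M \<Lambda> M). 0 < marginal n M p \<Lambda> y}. gibbs_gap n M c \<Lambda> y l)"

section \<open>Correlation coefficients\<close>

text \<open>\<open>Y i\<close>, for \<open>i\<close> in the finite set \<open>I\<close>, are random elements of \<open>N i\<close> on the probability space
  \<open>P\<close>.  Again \<open>0\<close> is inserted only for the case that there is no admissible \<open>f\<close>.\<close>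

definition s_star ::
  "'b measure \<Rightarrow> 'i set \<Rightarrow> ('i \<Rightarrow> 'a measure) \<Rightarrow> ('i \<Rightarrow> 'b \<Rightarrow> 'a) \<Rightarrow> ereal" where
  "s_star P I N Y = Sup (insert 0
     {ereal ((LINT \<omega>|P. (\<Sum>i\<in>I. f i (Y i \<omega>))\<^sup>2) /
             (real (card I) * (\<Sum>i\<in>I. LINT \<omega>|P. (f i (Y i \<omega>))\<^sup>2))) | f.
       (\<forall>i\<in>I. f i \<in> L20 (distr P (N i) (Y i))) \<and> (\<exists>i\<in>I. 0 < (LINT \<omega>|P. (f i (Y i \<omega>))\<^sup>2))})"

definition corr ::
  "nat \<Rightarrow> (nat \<Rightarrow> 'a measure) \<Rightarrow> (nat set \<Rightarrow> nat set \<Rightarrow> (nat \<Rightarrow> 'a) \<Rightarrow> (nat \<Rightarrow> 'a) \<Rightarrow> real) \<Rightarrow>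
   nat set \<Rightarrow> (nat \<Rightarrow> 'a) \<Rightarrow> ereal" where
  "corr n M c \<Lambda> y =
     s_star (cond_dist M c ({1..n} - \<Lambda>) \<Lambda> y) ({1..n} - \<Lambda>) M (\<lambda>i z. z i)"

definition max_corr ::
  "nat \<Rightarrow> (nat \<Rightarrow> 'a measure) \<Rightarrow> ((nat \<Rightarrow> 'a) \<Rightarrow> real) \<Rightarrow>
   (nat set \<Rightarrow> nat set \<Rightarrow> (nat \<Rightarrow> 'a) \<Rightarrow> (nat \<Rightarrow> 'a) \<Rightarrow> real) \<Rightarrow> nat \<Rightarrow> ereal" where
  "max_corr n M p c m =
     (MAX \<Lambda>\<in>{\<Lambda>. \<Lambda> \<subseteq> {1..n} \<and> card \<Lambda> = n - m}.
        SUP y\<in>{y \<in> space (Pi\<^sub>M \<Lambda> M). 0 < marginal n M p \<Lambda> y}. corr n M c \<Lambda> y)"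

end

theory Submission
  imports Defs
begin

text \<open>
  Let \<open>P\<^sub>\<Gamma>\<close> be the operator that resamples the coordinates in \<open>\<Gamma>\<close> from their conditional law
  given all the others.  Fix a set \<open>A\<close> of \<open>m\<close> coordinates and a value of the coordinates outside
  \<open>A\<close> with positive marginal density, and let \<open>\<mu>\<close> be the conditional law of the state.  For
  nonempty \<open>\<Gamma> \<subseteq> A\<close>, the law \<open>\<mu>\<close> is invariant under \<open>P\<^sub>\<Gamma>\<close>, and \<open>P\<^sub>\<Gamma>\<close> is the orthogonal
  projection of \<open>L\<^sup>2(\<mu>)\<close> onto the functions that do not depend on the coordinates in \<open>\<Gamma>\<close>
  (\<open>resampling_resample\<close>, \<open>kernel_op_symmetric\<close>).  The Gibbs sampler with block size \<open>l\<close> is the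
  average \<open>T\<close> of the \<open>P\<^sub>\<Gamma>\<close> with \<open>|\<Gamma>| = l\<close>.

  Block size \<open>m - 1\<close>.  For \<open>f\<close> of mean zero, \<open>f\<^sub>i = P\<^bsub>A - {i}\<^esub> f\<close> is a function of the
  \<open>i\<close>-th coordinate with mean zero, so the correlation coefficient \<open>s\<close> gives
  \<open>\<parallel>\<Sum> f\<^sub>i\<parallel>\<^sup>2 \<le> m s \<Sum> \<parallel>f\<^sub>i\<parallel>\<^sup>2\<close>.  As \<open>\<Sum> \<parallel>f\<^sub>i\<parallel>\<^sup>2 = \<langle>f, \<Sum> f\<^sub>i\<rangle>\<close>, the Cauchy-Schwarz inequality
  yields \<open>\<Sum> \<parallel>f\<^sub>i\<parallel>\<^sup>2 \<le> m s \<parallel>f\<parallel>\<^sup>2\<close>, that is \<open>\<langle>f, T f\<rangle> \<le> s \<parallel>f\<parallel>\<^sup>2\<close> (\<open>sum_kernel_op_sq_le\<close>,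
  \<open>one_coordinate_step\<close>).

  Smaller blocks.  A uniform \<open>\<Gamma> \<subseteq> A\<close> of size \<open>l < m\<close> is obtained by first removing a uniform
  \<open>i \<in> A\<close> and then choosing a uniform subset of \<open>A - {i}\<close> of size \<open>l\<close>.  Applying the
  inequality for \<open>A - {i}\<close> conditionally on the other coordinates, integrating, and then using the
  case of block size \<open>m - 1\<close> multiplies the constants; by induction on \<open>m\<close>
  \[ \langle f, T f\rangle \le \Bigl(1 - \prod_{k=l+1}^m (1 - S(k))\Bigr) \|f\|^2 \]
  for \<open>f\<close> of mean zero (\<open>block_bound\<close>, which is stated for arbitrary means).  Finally
  \<open>\<langle>f, T f\<rangle> \<le> r \<parallel>f\<parallel>\<^sup>2\<close> for all \<open>f\<close> of mean zero implies \<open>\<parallel>T f\<parallel> \<le> r \<parallel>f\<parallel>\<close>, because \<open>T\<close> is positive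
  semidefinite (\<open>average_kernel_op_sq_le\<close>).

  All kernels act on the full state space, so that conditioning on more coordinates only changes
  the law \<open>\<mu>\<close> and not the operators.
\<close>

text \<open>Index sets are kept in the form \<open>{1..n}\<close>, without rewriting the bound to \<open>Suc 0\<close>.\<close>

declare One_nat_def [simp del]

section \<open>Square-integrable functions and finite mixtures\<close>

lemma square_integrable_mult:
  fixes f g :: "'b \<Rightarrow> real"
  assumes [measurable]: "f \<in> borel_measurable N" "g \<in> borel_measurable N"
    and "integrable N (\<lambda>x. (f x)\<^sup>2)" "integrable N (\<lambda>x. (g x)\<^sup>2)"
  shows "integrable N (\<lambda>x. f x * g x)"
proof (rule Bochner_Integration.integrable_bound)
  show "integrable N (\<lambda>x. (f x)\<^sup>2 + (g x)\<^sup>2)" using assms by simp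
  have "\<bar>a * b\<bar> \<le> a\<^sup>2 + b\<^sup>2" for a b :: real
    using sum_squares_bound[of "\<bar>a\<bar>" "\<bar>b\<bar>"] mult_nonneg_nonneg[OF abs_ge_zero[of a] abs_ge_zero[of b]]
    unfolding abs_mult power2_abs by linarith
  then show "AE x in N. norm (f x * g x) \<le> norm ((f x)\<^sup>2 + (g x)\<^sup>2)"
    by simp
qed simp

lemma square_integrable_add:
  fixes f g :: "'b \<Rightarrow> real"
  assumes "f \<in> borel_measurable N" "g \<in> borel_measurable N"
    and "integrable N (\<lambda>x. (f x)\<^sup>2)" "integrable N (\<lambda>x. (g x)\<^sup>2)"
  shows "integrable N (\<lambda>x. (f x + g x)\<^sup>2)"
  using assms square_integrable_mult[OF assms] by (simp add: power2_sum mult.assoc)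

lemma square_integrable_sum:
  fixes f :: "'i \<Rightarrow> 'b \<Rightarrow> real"
  assumes "\<And>i. i \<in> I \<Longrightarrow> f i \<in> borel_measurable N"
    and "\<And>i. i \<in> I \<Longrightarrow> integrable N (\<lambda>x. (f i x)\<^sup>2)"
  shows "integrable N (\<lambda>x. (\<Sum>i\<in>I. f i x)\<^sup>2)"
  using assms
proof (induction I rule: infinite_finite_induct)
  case (insert i I)
  then show ?case
    using square_integrable_add[of "f i" N "\<lambda>x. \<Sum>i\<in>I. f i x"] by simp
qed simp_all

lemma (in prob_space) square_integrable_imp_integrable:
  fixes f :: "'a \<Rightarrow> real"
  assumes "f \<in> borel_measurable M" "integrable M (\<lambda>x. (f x)\<^sup>2)"
  shows "integrable M f"
  using square_integrable_mult[of f M "\<lambda>_. 1"] assms by simp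

lemma integral_sum_sq_le:
  fixes f :: "'i \<Rightarrow> 'b \<Rightarrow> real"
  assumes "\<And>i. i \<in> I \<Longrightarrow> f i \<in> borel_measurable N"
    and "\<And>i. i \<in> I \<Longrightarrow> integrable N (\<lambda>x. (f i x)\<^sup>2)"
  shows "(LINT x|N. (\<Sum>i\<in>I. f i x)\<^sup>2) \<le> card I * (\<Sum>i\<in>I. LINT x|N. (f i x)\<^sup>2)"
proof -
  have "(LINT x|N. (\<Sum>i\<in>I. f i x)\<^sup>2) \<le> (LINT x|N. (\<Sum>i\<in>I. (f i x)\<^sup>2) * card I)"
    using assms by (intro integral_mono square_integrable_sum sum_squared_le_sum_of_squares
        integrable_mult_left Bochner_Integration.integrable_sum) auto
  also have "\<dots> = card I * (\<Sum>i\<in>I. LINT x|N. (f i x)\<^sup>2)"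
    using assms by (simp add: Bochner_Integration.integral_sum mult.commute)
  finally show ?thesis .
qed

lemma nn_integral_mult_0:
  assumes "(\<integral>\<^sup>+x. f x \<partial>N) = 0" "f \<in> borel_measurable N"
  shows "(\<integral>\<^sup>+x. f x * g x \<partial>N) = (0::ennreal)"
proof -
  have "AE x in N. f x = 0" using assms by (simp add: nn_integral_0_iff_AE)
  then have "(\<integral>\<^sup>+x. f x * g x \<partial>N) = (\<integral>\<^sup>+x. 0 \<partial>N)"
    by (intro nn_integral_cong_AE) auto
  then show ?thesis by simp
qed

text \<open>The integrand need not be bounded: the mixture is finite, so integrability with respect to every
  component suffices.\<close>

lemma integral_bind_uniform_count_measure:
  fixes f :: "'b \<Rightarrow> real"
  assumes T: "finite T" "T \<noteq> {}" and N: "\<And>t. t \<in> T \<Longrightarrow> prob_space (N t)"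
    and sets_N: "\<And>t. t \<in> T \<Longrightarrow> sets (N t) = sets B"
    and f: "f \<in> borel_measurable B" and int: "\<And>t. t \<in> T \<Longrightarrow> integrable (N t) f"
  shows "(LINT x|bind (uniform_count_measure T) N. f x) = (\<Sum>t\<in>T. LINT x|N t. f x) / card T"
proof -
  have N': "N \<in> uniform_count_measure T \<rightarrow>\<^sub>M subprob_algebra B"
    unfolding measurable_cong_sets[OF sets_uniform_count_measure_count_space refl]
    using N sets_N by (auto simp: space_subprob_algebra prob_space_imp_subprob_space)
  have pos: "0 < card T" using T by (simp add: card_gt_0_iff)
  have sets: "sets (bind (uniform_count_measure T) N) = sets B"
    by (rule sets_bind) (use T sets_N in \<open>auto simp: space_uniform_count_measure\<close>)
  have nn: "(\<integral>\<^sup>+x. g x \<partial>bind (uniform_count_measure T) N) =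
      (\<Sum>t\<in>T. ennreal (1 / card T) * (\<integral>\<^sup>+x. g x \<partial>N t))" if "g \<in> borel_measurable B" for g
    using nn_integral_bind[OF that N'] T(1)
    by (simp add: uniform_count_measure_def nn_integral_point_measure_finite)
  have fN: "f \<in> borel_measurable (N t)" if "t \<in> T" for t
    using f measurable_cong_sets[OF sets_N[OF that] refl] by blast
  have fb: "f \<in> borel_measurable (bind (uniform_count_measure T) N)"
    using f measurable_cong_sets[OF sets refl] by blast
  have fin: "(\<integral>\<^sup>+x. ennreal (f x) \<partial>N t) < top" "(\<integral>\<^sup>+x. ennreal (- f x) \<partial>N t) < top" if "t \<in> T" for t
    using int[OF that] unfolding real_integrable_def by (auto simp: less_top)
  have sum_fin: "(\<Sum>t\<in>T. ennreal (1 / card T) * a t) \<noteq> top" if "\<And>t. t \<in> T \<Longrightarrow> a t < top" for a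
    using that by (auto simp: ennreal_mult_eq_top_iff T(1) less_top)
  have bound: "integrable (bind (uniform_count_measure T) N) f"
    unfolding real_integrable_def infinity_ennreal_def
    using fb f sum_fin[OF fin(1)] sum_fin[OF fin(2)] by (simp add: nn)
  have "enn2real (\<Sum>t\<in>T. ennreal (1 / card T) * a t) = (\<Sum>t\<in>T. enn2real (a t)) / card T"
    if "\<And>t. t \<in> T \<Longrightarrow> a t < top" for a
    using that by (subst enn2real_sum)
      (auto simp: ennreal_mult_less_top enn2real_mult sum_divide_distrib)
  note eq = this
  show ?thesis
    unfolding real_lebesgue_integral_def[OF bound]
    using f fin int by (simp add: nn eq real_lebesgue_integral_def diff_divide_distrib sum_subtractf)
qed

text \<open>Double counting: a subset of size \<open>l\<close> avoids exactly \<open>card A - l\<close> elements of \<open>A\<close>.\<close>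

lemma sum_subsets_remove:
  fixes h :: "'i set \<Rightarrow> real"
  assumes A: "finite A"
  shows "(\<Sum>i\<in>A. \<Sum>\<Gamma> | \<Gamma> \<subseteq> A - {i} \<and> card \<Gamma> = l. h \<Gamma>) =
    (card A - l) * (\<Sum>\<Gamma> | \<Gamma> \<subseteq> A \<and> card \<Gamma> = l. h \<Gamma>)"
proof -
  let ?T = "{\<Gamma>. \<Gamma> \<subseteq> A \<and> card \<Gamma> = l}"
  have fin: "finite ?T" using A by (auto intro: finite_subset[of _ "Pow A"])
  have "(\<Sum>i\<in>A. \<Sum>\<Gamma> | \<Gamma> \<subseteq> A - {i} \<and> card \<Gamma> = l. h \<Gamma>) = (\<Sum>i\<in>A. \<Sum>\<Gamma> | \<Gamma> \<in> ?T \<and> i \<notin> \<Gamma>. h \<Gamma>)"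
    by (intro sum.cong) auto
  also have "\<dots> = (\<Sum>\<Gamma>\<in>?T. \<Sum>i | i \<in> A \<and> i \<notin> \<Gamma>. h \<Gamma>)"
    by (rule sum.swap_restrict[OF A fin])
  also have "\<dots> = (\<Sum>\<Gamma>\<in>?T. real (card A - l) * h \<Gamma>)"
  proof (rule sum.cong[OF refl])
    fix \<Gamma> assume G: "\<Gamma> \<in> ?T"
    have "{i. i \<in> A \<and> i \<notin> \<Gamma>} = A - \<Gamma>" by auto
    moreover have "card (A - \<Gamma>) = card A - l"
      using G finite_subset[OF _ A] by (auto simp: card_Diff_subset)
    ultimately show "(\<Sum>i | i \<in> A \<and> i \<notin> \<Gamma>. h \<Gamma>) = real (card A - l) * h \<Gamma>"
      by simp
  qed
  finally show ?thesis by (simp add: sum_distrib_left)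
qed

section \<open>Kernels acting as orthogonal projections\<close>

text \<open>A Markov kernel \<open>\<kappa>\<close> with invariant law \<open>\<mu>\<close> whose operator maps each function to one that is
  almost surely constant under every \<open>\<kappa> x\<close>.  Together, these properties make \<open>kernel_op \<kappa>\<close> a
  conditional expectation, hence an orthogonal projection of \<open>L\<^sup>2(\<mu>)\<close>.  Idempotence is stated for
  functions rather than as \<open>\<kappa> x' = \<kappa> x\<close>, so that the exceptional event is measurable.\<close>

locale resampling = prob_space \<mu> for \<mu> :: "'s measure" +
  fixes \<kappa> :: "'s \<Rightarrow> 's measure"
  assumes kernel[measurable]: "\<kappa> \<in> \<mu> \<rightarrow>\<^sub>M prob_algebra \<mu>"
    and invariant: "\<mu> \<bind> \<kappa> = \<mu>"
    and idempotent: "\<And>f x. f \<in> borel_measurable \<mu> \<Longrightarrow> x \<in> space \<mu> \<Longrightarrow>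
      AE x' in \<kappa> x. kernel_op \<kappa> f x' = kernel_op \<kappa> f x"
begin

lemma kernel_subprob[measurable]: "\<kappa> \<in> \<mu> \<rightarrow>\<^sub>M subprob_algebra \<mu>"
  by (rule measurable_prob_algebraD) measurable

lemma sets_kernel_eq: "x \<in> space \<mu> \<Longrightarrow> sets (\<kappa> x) = sets \<mu>"
  using measurable_space[OF kernel] by (auto simp: space_prob_algebra)

lemma prob_kernel: "x \<in> space \<mu> \<Longrightarrow> prob_space (\<kappa> x)"
  using measurable_space[OF kernel] by (auto simp: space_prob_algebra)

lemma measurable_kernel: "x \<in> space \<mu> \<Longrightarrow> f \<in> borel_measurable \<mu> \<Longrightarrow> f \<in> borel_measurable (\<kappa> x)"
  using measurable_cong_sets[OF sets_kernel_eq refl] by blast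

lemma measurable_kernel_op[measurable]:
  assumes [measurable]: "f \<in> borel_measurable \<mu>"
  shows "kernel_op \<kappa> f \<in> borel_measurable \<mu>"
  unfolding kernel_op_def by measurable

lemma nn_integral_kernel:
  assumes "f \<in> borel_measurable \<mu>"
  shows "(\<integral>\<^sup>+x. (\<integral>\<^sup>+x'. f x' \<partial>\<kappa> x) \<partial>\<mu>) = (\<integral>\<^sup>+x. f x \<partial>\<mu>)"
  using nn_integral_bind[OF assms kernel_subprob] invariant by simp

lemma AE_integrable_kernel:
  fixes f :: "'s \<Rightarrow> real"
  assumes f: "integrable \<mu> f"
  shows "AE x in \<mu>. integrable (\<kappa> x) f"
proof -
  have [measurable]: "f \<in> borel_measurable \<mu>" using f by auto
  have "(\<integral>\<^sup>+x. (\<integral>\<^sup>+x'. norm (f x') \<partial>\<kappa> x) \<partial>\<mu>) \<noteq> \<infinity>"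
    using f by (subst nn_integral_kernel) (auto simp: integrable_iff_bounded)
  then have "AE x in \<mu>. (\<integral>\<^sup>+x'. norm (f x') \<partial>\<kappa> x) \<noteq> \<infinity>"
    by (intro nn_integral_PInf_AE) auto
  with AE_space show ?thesis
    by eventually_elim (auto simp: integrable_iff_bounded measurable_kernel less_top)
qed

lemma kernel_op_nonneg:
  fixes f :: "'s \<Rightarrow> real"
  assumes f: "integrable \<mu> f" and nn: "\<And>x. 0 \<le> f x"
  shows "integrable \<mu> (kernel_op \<kappa> f)" "(LINT x|\<mu>. kernel_op \<kappa> f x) = (LINT x|\<mu>. f x)"
proof -
  have [measurable]: "f \<in> borel_measurable \<mu>" using f by auto
  have "(\<integral>\<^sup>+x. ennreal (kernel_op \<kappa> f x) \<partial>\<mu>) = (\<integral>\<^sup>+x. (\<integral>\<^sup>+x'. ennreal (f x') \<partial>\<kappa> x) \<partial>\<mu>)"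
    using AE_integrable_kernel[OF f]
    by (intro nn_integral_cong_AE, eventually_elim)
       (simp add: kernel_op_def nn_integral_eq_integral nn)
  also have "\<dots> = (\<integral>\<^sup>+x. ennreal (f x) \<partial>\<mu>)" by (rule nn_integral_kernel) measurable
  finally have eq: "(\<integral>\<^sup>+x. ennreal (kernel_op \<kappa> f x) \<partial>\<mu>) = (\<integral>\<^sup>+x. ennreal (f x) \<partial>\<mu>)" .
  have nn': "0 \<le> kernel_op \<kappa> f x" for x unfolding kernel_op_def using nn by simp
  show "integrable \<mu> (kernel_op \<kappa> f)"
    using f nn nn' eq by (simp add: integrable_iff_bounded)
  show "(LINT x|\<mu>. kernel_op \<kappa> f x) = (LINT x|\<mu>. f x)"
    using eq by (simp add: integral_eq_nn_integral nn nn')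
qed

lemma integral_kernel_op:
  fixes f :: "'s \<Rightarrow> real"
  assumes f: "integrable \<mu> f"
  shows "integrable \<mu> (kernel_op \<kappa> f)" "(LINT x|\<mu>. kernel_op \<kappa> f x) = (LINT x|\<mu>. f x)"
proof -
  have [measurable]: "f \<in> borel_measurable \<mu>" using f by auto
  define g where "g = (\<lambda>x. max 0 (f x))"
  define h where "h = (\<lambda>x. max 0 (- f x))"
  have g: "integrable \<mu> g" and h: "integrable \<mu> h" and f_eq: "f = (\<lambda>x. g x - h x)"
    using f by (auto simp: g_def h_def)
  have nn: "0 \<le> g x" "0 \<le> h x" for x by (auto simp: g_def h_def)
  note G = kernel_op_nonneg[OF g nn(1)] and H = kernel_op_nonneg[OF h nn(2)]
  have AE: "AE x in \<mu>. kernel_op \<kappa> g x - kernel_op \<kappa> h x = kernel_op \<kappa> f x"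
    using AE_integrable_kernel[OF g] AE_integrable_kernel[OF h]
    by eventually_elim (simp add: kernel_op_def f_eq)
  show "integrable \<mu> (kernel_op \<kappa> f)"
    using Bochner_Integration.integrable_diff[OF G(1) H(1)] integrable_cong_AE[OF _ _ AE] G(1) H(1)
    by simp
  have "(LINT x|\<mu>. kernel_op \<kappa> f x) = (LINT x|\<mu>. kernel_op \<kappa> g x - kernel_op \<kappa> h x)"
    using AE G(1) H(1) by (intro integral_cong_AE) auto
  also have "\<dots> = (LINT x|\<mu>. f x)" using G H g h by (simp add: f_eq)
  finally show "(LINT x|\<mu>. kernel_op \<kappa> f x) = (LINT x|\<mu>. f x)" .
qed

lemma square_kernel_op_le:
  fixes f :: "'s \<Rightarrow> real"
  assumes [measurable]: "f \<in> borel_measurable \<mu>" and x: "x \<in> space \<mu>"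
    and f2: "integrable (\<kappa> x) (\<lambda>x. (f x)\<^sup>2)"
  shows "(kernel_op \<kappa> f x)\<^sup>2 \<le> kernel_op \<kappa> (\<lambda>x. (f x)\<^sup>2) x"
proof -
  interpret K: prob_space "\<kappa> x" by (rule prob_kernel[OF x])
  have "f \<in> borel_measurable (\<kappa> x)" by (rule measurable_kernel[OF x]) measurable
  then have "integrable (\<kappa> x) f" using f2 by (rule K.square_integrable_imp_integrable)
  from K.variance_eq[OF this f2] K.variance_positive[of f] show ?thesis
    by (simp add: kernel_op_def)
qed

lemma square_integrable_kernel_op:
  fixes f :: "'s \<Rightarrow> real"
  assumes [measurable]: "f \<in> borel_measurable \<mu>" and f2: "integrable \<mu> (\<lambda>x. (f x)\<^sup>2)"
  shows "integrable \<mu> (\<lambda>x. (kernel_op \<kappa> f x)\<^sup>2)"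
proof (rule Bochner_Integration.integrable_bound)
  show "integrable \<mu> (kernel_op \<kappa> (\<lambda>x. (f x)\<^sup>2))" using f2 by (rule integral_kernel_op)
  show "AE x in \<mu>. norm ((kernel_op \<kappa> f x)\<^sup>2) \<le> norm (kernel_op \<kappa> (\<lambda>x. (f x)\<^sup>2) x)"
    using AE_integrable_kernel[OF f2] AE_space
  proof eventually_elim
    case (elim x)
    from square_kernel_op_le[OF _ elim(2,1)] show ?case by simp
  qed
qed measurable

text \<open>Self-adjointness and idempotence of the projection in one identity.\<close>

lemma kernel_op_symmetric:
  fixes f g :: "'s \<Rightarrow> real"
  assumes [measurable]: "f \<in> borel_measurable \<mu>" "g \<in> borel_measurable \<mu>"
    and f2: "integrable \<mu> (\<lambda>x. (f x)\<^sup>2)" and g2: "integrable \<mu> (\<lambda>x. (g x)\<^sup>2)"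
  shows "(LINT x|\<mu>. f x * kernel_op \<kappa> g x) = (LINT x|\<mu>. kernel_op \<kappa> f x * kernel_op \<kappa> g x)"
proof -
  have int: "integrable \<mu> (\<lambda>x. f x * kernel_op \<kappa> g x)"
    by (intro square_integrable_mult f2 square_integrable_kernel_op g2) measurable
  have "(LINT x|\<mu>. f x * kernel_op \<kappa> g x) = (LINT x|\<mu>. kernel_op \<kappa> (\<lambda>x. f x * kernel_op \<kappa> g x) x)"
    using integral_kernel_op(2)[OF int] by simp
  also have "\<dots> = (LINT x|\<mu>. kernel_op \<kappa> f x * kernel_op \<kappa> g x)"
  proof (rule Bochner_Integration.integral_cong[OF refl])
    fix x assume x: "x \<in> space \<mu>"
    \<comment> \<open>\<open>kernel_op \<kappa> g\<close> is almost surely constant under \<open>\<kappa> x\<close>, so it can be taken out.\<close>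
    have "kernel_op \<kappa> (\<lambda>x. f x * kernel_op \<kappa> g x) x = (LINT x'|\<kappa> x. f x' * kernel_op \<kappa> g x)"
      unfolding kernel_op_def[of _ "\<lambda>x. f x * kernel_op \<kappa> g x"]
    proof (rule integral_cong_AE)
      show "AE x' in \<kappa> x. f x' * kernel_op \<kappa> g x' = f x' * kernel_op \<kappa> g x"
        using idempotent[OF assms(2) x] by eventually_elim simp
    qed (intro measurable_kernel[OF x] borel_measurable_times borel_measurable_const measurable_kernel_op assms)+
    then show "kernel_op \<kappa> (\<lambda>x. f x * kernel_op \<kappa> g x) x = kernel_op \<kappa> f x * kernel_op \<kappa> g x"
      by (simp add: kernel_op_def)
  qed
  finally show ?thesis .
qed

lemma kernel_op_sq:
  fixes f :: "'s \<Rightarrow> real"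
  assumes "f \<in> borel_measurable \<mu>" "integrable \<mu> (\<lambda>x. (f x)\<^sup>2)"
  shows "(LINT x|\<mu>. f x * kernel_op \<kappa> f x) = (LINT x|\<mu>. (kernel_op \<kappa> f x)\<^sup>2)"
  using kernel_op_symmetric[OF assms(1,1,2,2)] by (simp add: power2_eq_square)

text \<open>Centring a function subtracts the square of its mean from the squared norm of its projection.\<close>

lemma kernel_op_sq_diff_const:
  fixes f :: "'s \<Rightarrow> real"
  assumes [measurable]: "f \<in> borel_measurable \<mu>" and f2: "integrable \<mu> (\<lambda>x. (f x)\<^sup>2)"
  shows "(LINT x|\<mu>. (kernel_op \<kappa> (\<lambda>x. f x - expectation f) x)\<^sup>2) =
    (LINT x|\<mu>. (kernel_op \<kappa> f x)\<^sup>2) - (expectation f)\<^sup>2"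
proof -
  have f: "integrable \<mu> f" using f2 by (rule square_integrable_imp_integrable[rotated]) simp
  have Qf: "integrable \<mu> (kernel_op \<kappa> f)" "expectation (kernel_op \<kappa> f) = expectation f"
    using integral_kernel_op[OF f] by simp_all
  have "(LINT x|\<mu>. (kernel_op \<kappa> (\<lambda>x. f x - expectation f) x)\<^sup>2) =
      (LINT x|\<mu>. (kernel_op \<kappa> f x - expectation f)\<^sup>2)"
  proof (rule integral_cong_AE)
    show "AE x in \<mu>. (kernel_op \<kappa> (\<lambda>x. f x - expectation f) x)\<^sup>2 = (kernel_op \<kappa> f x - expectation f)\<^sup>2"
      using AE_integrable_kernel[OF f] AE_space
    proof eventually_elim
      case (elim x)
      interpret K: prob_space "\<kappa> x" by (rule prob_kernel[OF elim(2)])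
      show ?case using elim(1) by (simp add: kernel_op_def K.prob_space)
    qed
  qed measurable
  also have "\<dots> = variance (kernel_op \<kappa> f)" by (simp add: Qf)
  also have "\<dots> = (LINT x|\<mu>. (kernel_op \<kappa> f x)\<^sup>2) - (expectation f)\<^sup>2"
    using variance_eq[OF Qf(1) square_integrable_kernel_op[OF _ f2]] by (simp add: Qf)
  finally show ?thesis .
qed

end

section \<open>Averages of projections\<close>

text \<open>The weighted form of \<open>2 a b \<le> a\<^sup>2 + b\<^sup>2\<close>; integrated, with a suitable \<open>t\<close>, it replaces the
  Cauchy-Schwarz inequality.\<close>

lemma two_mult_le:
  fixes a b t :: real assumes "0 < t" shows "2 * (a * b) \<le> t * a\<^sup>2 + b\<^sup>2 / t"
proof -
  have "0 \<le> (t * a - b)\<^sup>2 / t" using assms by simp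
  also have "\<dots> = t * a\<^sup>2 + b\<^sup>2 / t - 2 * (a * b)"
    using assms by (simp add: power2_eq_square field_simps)
  finally show ?thesis by simp
qed

text \<open>Since \<open>\<Sum> \<parallel>P\<^sub>i f\<parallel>\<^sup>2 = \<langle>f, \<Sum> P\<^sub>i f\<rangle>\<close> for projections, a bound of the norm of the sum
  \<open>\<Sum> P\<^sub>i f\<close> by the norms of its terms turns into a bound of these norms by the norm of \<open>f\<close>.\<close>

lemma sum_kernel_op_sq_le:
  fixes f :: "'s \<Rightarrow> real"
  assumes I: "finite I" and res: "\<And>i. i \<in> I \<Longrightarrow> resampling \<mu> (\<kappa> i)"
    and f[measurable]: "f \<in> borel_measurable \<mu>" and f2: "integrable \<mu> (\<lambda>x. (f x)\<^sup>2)"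
    and corr: "(LINT x|\<mu>. (\<Sum>i\<in>I. kernel_op (\<kappa> i) f x)\<^sup>2) \<le> r * (\<Sum>i\<in>I. LINT x|\<mu>. (kernel_op (\<kappa> i) f x)\<^sup>2)"
    and r: "0 \<le> r"
  shows "(\<Sum>i\<in>I. LINT x|\<mu>. (kernel_op (\<kappa> i) f x)\<^sup>2) \<le> r * (LINT x|\<mu>. (f x)\<^sup>2)"
proof -
  define H where "H = (\<lambda>x. \<Sum>i\<in>I. kernel_op (\<kappa> i) f x)"
  define a where "a = (\<Sum>i\<in>I. LINT x|\<mu>. (kernel_op (\<kappa> i) f x)\<^sup>2)"
  have Q[measurable]: "kernel_op (\<kappa> i) f \<in> borel_measurable \<mu>"
    and Q2: "integrable \<mu> (\<lambda>x. (kernel_op (\<kappa> i) f x)\<^sup>2)" if "i \<in> I" for i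
    using resampling.measurable_kernel_op[OF res[OF that] f]
      resampling.square_integrable_kernel_op[OF res[OF that] f f2] by auto
  have H[measurable]: "H \<in> borel_measurable \<mu>" unfolding H_def using Q by (rule borel_measurable_sum)
  have H2: "integrable \<mu> (\<lambda>x. (H x)\<^sup>2)"
    unfolding H_def using Q Q2 by (rule square_integrable_sum)
  have "(LINT x|\<mu>. f x * H x) = (\<Sum>i\<in>I. LINT x|\<mu>. f x * kernel_op (\<kappa> i) f x)"
    unfolding H_def sum_distrib_left
    by (intro Bochner_Integration.integral_sum square_integrable_mult f f2 Q Q2)
  also have "\<dots> = a"
    unfolding a_def by (intro sum.cong refl resampling.kernel_op_sq res f f2)
  finally have a: "(LINT x|\<mu>. f x * H x) = a" .
  have le: "2 * a \<le> t * (LINT x|\<mu>. (f x)\<^sup>2) + (LINT x|\<mu>. (H x)\<^sup>2) / t" if t: "0 < t" for t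
  proof -
    have "2 * a = (LINT x|\<mu>. 2 * (f x * H x))" by (simp add: a)
    also have "\<dots> \<le> (LINT x|\<mu>. t * (f x)\<^sup>2 + (H x)\<^sup>2 / t)"
      by (intro integral_mono Bochner_Integration.integrable_add integrable_mult_right integrable_divide
          square_integrable_mult f H f2 H2 two_mult_le t)
    also have "\<dots> = t * (LINT x|\<mu>. (f x)\<^sup>2) + (LINT x|\<mu>. (H x)\<^sup>2) / t"
      using f2 H2 by simp
    finally show ?thesis .
  qed
  have H_le: "(LINT x|\<mu>. (H x)\<^sup>2) \<le> r * a" using corr by (simp add: H_def a_def)
  show ?thesis
  proof (cases "r = 0")
    case True
    \<comment> \<open>Here \<open>\<Sum> P\<^sub>i f = 0\<close> almost everywhere, and \<open>t\<close> may tend to \<open>0\<close>.\<close>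
    then have H0: "(LINT x|\<mu>. (H x)\<^sup>2) \<le> 0" using H_le by simp
    define N where "N = (LINT x|\<mu>. (f x)\<^sup>2)"
    have N: "0 \<le> N" by (simp add: N_def)
    have "a \<le> e" if e: "0 < e" for e
    proof -
      define t where "t = e / (N + 1)"
      have t: "0 < t" using e N by (simp add: t_def)
      have "2 * a \<le> t * N + (LINT x|\<mu>. (H x)\<^sup>2) / t" using le[OF t] by (simp add: N_def)
      also have "\<dots> \<le> t * N" using H0 t by (simp add: divide_le_0_iff)
      also have "\<dots> \<le> e" using e N by (simp add: t_def field_simps)
      finally show ?thesis using e by simp
    qed
    then have "a \<le> 0" by (rule field_le_epsilon[of a 0, simplified])
    then show ?thesis using True by (simp add: a_def)
  next
    case False
    then have pos: "0 < r" using r by simp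
    have "2 * a \<le> r * (LINT x|\<mu>. (f x)\<^sup>2) + (LINT x|\<mu>. (H x)\<^sup>2) / r" by (rule le[OF pos])
    also have "(LINT x|\<mu>. (H x)\<^sup>2) / r \<le> a" using H_le pos by (simp add: field_simps)
    finally show ?thesis by (simp add: a_def)
  qed
qed

text \<open>A bound of the quadratic form of an average \<open>T\<close> of projections is a bound of its operator norm.
  With \<open>G = T f\<close>, the square \<open>\<parallel>G\<parallel>\<^sup>2\<close> is the average of \<open>\<langle>P\<^sub>i G, P\<^sub>i f\<rangle>\<close>, to which the assumption on
  the quadratic form applies at both \<open>f\<close> and \<open>G\<close>.\<close>

lemma average_kernel_op_sq_le:
  fixes f :: "'s \<Rightarrow> real" and I :: "'i set"
  assumes I: "finite I" and prob: "prob_space \<mu>" and res: "\<And>i. i \<in> I \<Longrightarrow> resampling \<mu> (\<kappa> i)"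
    and form: "\<And>g. g \<in> L20 \<mu> \<Longrightarrow>
      (\<Sum>i\<in>I. LINT x|\<mu>. (kernel_op (\<kappa> i) g x)\<^sup>2) / card I \<le> r * (LINT x|\<mu>. (g x)\<^sup>2)"
    and r: "0 \<le> r" and f: "f \<in> L20 \<mu>"
  shows "(LINT x|\<mu>. ((\<Sum>i\<in>I. kernel_op (\<kappa> i) f x) / card I)\<^sup>2) \<le> r\<^sup>2 * (LINT x|\<mu>. (f x)\<^sup>2)"
proof -
  interpret prob_space \<mu> by (rule prob)
  define G where "G = (\<lambda>x. (\<Sum>i\<in>I. kernel_op (\<kappa> i) f x) / card I)"
  have f'[measurable]: "f \<in> borel_measurable \<mu>" and f2: "integrable \<mu> (\<lambda>x. (f x)\<^sup>2)"
    and f0: "expectation f = 0"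
    using f by (auto simp: L20_def)
  have Q[measurable]: "kernel_op (\<kappa> i) g \<in> borel_measurable \<mu>"
    and Q2: "integrable \<mu> (\<lambda>x. (kernel_op (\<kappa> i) g x)\<^sup>2)" 
    if "i \<in> I" "g \<in> borel_measurable \<mu>" "integrable \<mu> (\<lambda>x. (g x)\<^sup>2)" for i g
    using resampling.measurable_kernel_op[OF res[OF that(1)] that(2)]
      resampling.square_integrable_kernel_op[OF res[OF that(1)] that(2,3)] by auto
  have G[measurable]: "G \<in> borel_measurable \<mu>" unfolding G_def using Q[OF _ f' f2] by simp
  have G2: "integrable \<mu> (\<lambda>x. (G x)\<^sup>2)"
    unfolding G_def power_divide
    by (intro integrable_divide square_integrable_sum Q Q2 f' f2)
  have "expectation G = (\<Sum>i\<in>I. expectation (kernel_op (\<kappa> i) f)) / card I"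
    unfolding G_def using square_integrable_imp_integrable[OF Q[OF _ f' f2] Q2[OF _ f' f2]]
    by (simp add: Bochner_Integration.integral_sum)
  also have "\<dots> = 0"
    using resampling.integral_kernel_op(2)[OF res square_integrable_imp_integrable[OF f' f2]]
    by (simp add: f0)
  finally have GL: "G \<in> L20 \<mu>" using G G2 by (simp add: L20_def)
  have eq: "(LINT x|\<mu>. (G x)\<^sup>2) = (\<Sum>i\<in>I. LINT x|\<mu>. kernel_op (\<kappa> i) G x * kernel_op (\<kappa> i) f x) / card I"
  proof -
    have "(LINT x|\<mu>. (G x)\<^sup>2) = (LINT x|\<mu>. (\<Sum>i\<in>I. G x * kernel_op (\<kappa> i) f x) / card I)"
      unfolding power2_eq_square by (subst (2) G_def) (simp add: sum_distrib_left)
    also have "\<dots> = (\<Sum>i\<in>I. LINT x|\<mu>. G x * kernel_op (\<kappa> i) f x) / card I"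
      by (subst integral_divide_zero, subst Bochner_Integration.integral_sum)
         (auto intro!: square_integrable_mult G G2 Q Q2 f' f2)
    also have "(\<Sum>i\<in>I. LINT x|\<mu>. G x * kernel_op (\<kappa> i) f x) =
        (\<Sum>i\<in>I. LINT x|\<mu>. kernel_op (\<kappa> i) G x * kernel_op (\<kappa> i) f x)"
      by (intro sum.cong refl resampling.kernel_op_symmetric res G G2 f' f2)
    finally show ?thesis .
  qed
  have le: "2 * (LINT x|\<mu>. (G x)\<^sup>2) \<le> t * (r * (LINT x|\<mu>. (f x)\<^sup>2)) + (r * (LINT x|\<mu>. (G x)\<^sup>2)) / t"
    if t: "0 < t" for t
  proof -
    have "2 * (LINT x|\<mu>. (G x)\<^sup>2) =
        (\<Sum>i\<in>I. LINT x|\<mu>. 2 * (kernel_op (\<kappa> i) f x * kernel_op (\<kappa> i) G x)) / card I"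
      by (simp add: eq sum_distrib_left mult.commute)
    also have "\<dots> \<le> (\<Sum>i\<in>I. LINT x|\<mu>. t * (kernel_op (\<kappa> i) f x)\<^sup>2 + (kernel_op (\<kappa> i) G x)\<^sup>2 / t) / card I"
      by (intro divide_right_mono sum_mono integral_mono Bochner_Integration.integrable_add
          integrable_mult_right integrable_divide square_integrable_mult Q Q2 f' G f2 G2 two_mult_le t) auto
    also have "\<dots> = (\<Sum>i\<in>I. t * (LINT x|\<mu>. (kernel_op (\<kappa> i) f x)\<^sup>2) + (LINT x|\<mu>. (kernel_op (\<kappa> i) G x)\<^sup>2) / t) / card I"
      using Q2[OF _ f' f2] Q2[OF _ G G2] by simp
    also have "\<dots> = t * ((\<Sum>i\<in>I. LINT x|\<mu>. (kernel_op (\<kappa> i) f x)\<^sup>2) / card I) +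
        ((\<Sum>i\<in>I. LINT x|\<mu>. (kernel_op (\<kappa> i) G x)\<^sup>2) / card I) / t"
      by (simp add: sum.distrib add_divide_distrib sum_distrib_left[symmetric] sum_divide_distrib[symmetric] mult.commute)
    also have "\<dots> \<le> t * (r * (LINT x|\<mu>. (f x)\<^sup>2)) + (r * (LINT x|\<mu>. (G x)\<^sup>2)) / t"
      using t by (intro add_mono mult_left_mono divide_right_mono form f GL) auto
    finally show ?thesis .
  qed
  have "(LINT x|\<mu>. (G x)\<^sup>2) \<le> r\<^sup>2 * (LINT x|\<mu>. (f x)\<^sup>2)"
  proof (cases "r = 0")
    case True
    then show ?thesis using le[of 1] by simp
  next
    case False
    then have "0 < r" using r by simp
    from le[OF this] this show ?thesis by (simp add: power2_eq_square mult.assoc)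
  qed
  then show ?thesis by (simp add: G_def)
qed

section \<open>The correlation coefficient of finitely many random elements\<close>

lemma L20_distrD:
  assumes f: "f \<in> L20 (distr P N Y)" and Y: "Y \<in> P \<rightarrow>\<^sub>M N"
  shows "(\<lambda>\<omega>. f (Y \<omega>)) \<in> borel_measurable P" "integrable P (\<lambda>\<omega>. (f (Y \<omega>))\<^sup>2)"
proof -
  have [measurable]: "f \<in> borel_measurable N" using f by (simp add: L20_def)
  note Y[measurable]
  show "(\<lambda>\<omega>. f (Y \<omega>)) \<in> borel_measurable P" by measurable
  show "integrable P (\<lambda>\<omega>. (f (Y \<omega>))\<^sup>2)"
    using f by (simp add: L20_def integrable_distr_eq)
qed

text \<open>The Cauchy-Schwarz inequality \<open>(\<Sum>\<^bsub>i\<in>I\<^esub> a\<^sub>i)\<^sup>2 \<le> |I| \<Sum>\<^bsub>i\<in>I\<^esub> a\<^sub>i\<^sup>2\<close>, integrated.\<close>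

lemma s_star_le_1:
  assumes I: "finite I" and Y: "\<And>i. i \<in> I \<Longrightarrow> Y i \<in> P \<rightarrow>\<^sub>M N i"
  shows "s_star P I N Y \<le> 1"
  unfolding s_star_def
proof (rule Sup_least, safe)
  fix f i assume f: "\<forall>i\<in>I. f i \<in> L20 (distr P (N i) (Y i))"
    and i: "i \<in> I" "0 < (LINT \<omega>|P. (f i (Y i \<omega>))\<^sup>2)"
  have le: "(LINT \<omega>|P. (\<Sum>i\<in>I. f i (Y i \<omega>))\<^sup>2) \<le> card I * (\<Sum>i\<in>I. LINT \<omega>|P. (f i (Y i \<omega>))\<^sup>2)"
    by (rule integral_sum_sq_le[OF L20_distrD[OF f[rule_format] Y]])
  have "(LINT \<omega>|P. (f i (Y i \<omega>))\<^sup>2) \<le> (\<Sum>i\<in>I. LINT \<omega>|P. (f i (Y i \<omega>))\<^sup>2)"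
    using i I by (intro member_le_sum) auto
  then have "0 < card I * (\<Sum>i\<in>I. LINT \<omega>|P. (f i (Y i \<omega>))\<^sup>2)"
    using i I by (intro mult_pos_pos) (auto simp: card_gt_0_iff)
  then show "ereal ((LINT \<omega>|P. (\<Sum>i\<in>I. f i (Y i \<omega>))\<^sup>2) /
      (real (card I) * (\<Sum>i\<in>I. LINT \<omega>|P. (f i (Y i \<omega>))\<^sup>2))) \<le> 1"
    using le by (simp add: one_ereal_def)
qed simp

lemma s_star_nonneg: "0 \<le> s_star P I N Y"
  unfolding s_star_def by (rule Sup_upper) simp

text \<open>The defining inequality of the correlation coefficient without the exclusion of
  \<open>f = 0\<close>.\<close>

lemma integral_sum_sq_le_s_star:
  fixes s :: real
  assumes I: "finite I" and Y: "\<And>i. i \<in> I \<Longrightarrow> Y i \<in> P \<rightarrow>\<^sub>M N i"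
    and f: "\<And>i. i \<in> I \<Longrightarrow> f i \<in> L20 (distr P (N i) (Y i))" and s: "s_star P I N Y \<le> ereal s"
  shows "(LINT \<omega>|P. (\<Sum>i\<in>I. f i (Y i \<omega>))\<^sup>2) \<le> (card I * s) * (\<Sum>i\<in>I. LINT \<omega>|P. (f i (Y i \<omega>))\<^sup>2)"
proof (cases "\<exists>i\<in>I. 0 < (LINT \<omega>|P. (f i (Y i \<omega>))\<^sup>2)")
  case True
  then obtain i where i: "i \<in> I" "0 < (LINT \<omega>|P. (f i (Y i \<omega>))\<^sup>2)" by blast
  have "ereal ((LINT \<omega>|P. (\<Sum>i\<in>I. f i (Y i \<omega>))\<^sup>2) /
      (real (card I) * (\<Sum>i\<in>I. LINT \<omega>|P. (f i (Y i \<omega>))\<^sup>2))) \<le> s_star P I N Y"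
    unfolding s_star_def by (rule Sup_upper) (use f True in auto)
  then have "(LINT \<omega>|P. (\<Sum>i\<in>I. f i (Y i \<omega>))\<^sup>2) /
      (real (card I) * (\<Sum>i\<in>I. LINT \<omega>|P. (f i (Y i \<omega>))\<^sup>2)) \<le> s"
    using s by (meson ereal_less_eq(3) order_trans)
  moreover have "(LINT \<omega>|P. (f i (Y i \<omega>))\<^sup>2) \<le> (\<Sum>i\<in>I. LINT \<omega>|P. (f i (Y i \<omega>))\<^sup>2)"
    using i I by (intro member_le_sum) auto
  then have "0 < card I * (\<Sum>i\<in>I. LINT \<omega>|P. (f i (Y i \<omega>))\<^sup>2)"
    using i I by (intro mult_pos_pos) (auto simp: card_gt_0_iff)
  ultimately show ?thesis by (simp add: pos_divide_le_eq mult_ac)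
next
  case False
  then have "(LINT \<omega>|P. (f i (Y i \<omega>))\<^sup>2) = 0" if "i \<in> I" for i
    using that by (intro antisym) (auto simp: not_less)
  moreover have "(LINT \<omega>|P. (\<Sum>i\<in>I. f i (Y i \<omega>))\<^sup>2) \<le> card I * (\<Sum>i\<in>I. LINT \<omega>|P. (f i (Y i \<omega>))\<^sup>2)"
    by (rule integral_sum_sq_le[OF L20_distrD[OF f Y]])
  ultimately show ?thesis by simp
qed

section \<open>Resampling a block of coordinates\<close>

text \<open>A joint probability density \<open>p\<close> on \<open>n\<close> \<open>\<sigma>\<close>-finite coordinate spaces, with a choice \<open>c\<close> of
  conditional densities.\<close>

locale conditional_model =
  fixes n :: nat and M :: "nat \<Rightarrow> 'a measure" and p :: "(nat \<Rightarrow> 'a) \<Rightarrow> real"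
    and c :: "nat set \<Rightarrow> nat set \<Rightarrow> (nat \<Rightarrow> 'a) \<Rightarrow> (nat \<Rightarrow> 'a) \<Rightarrow> real"
  assumes sigma_finite: "\<And>i. i \<in> {1..n} \<Longrightarrow> sigma_finite_measure (M i)"
    and p_measurable[measurable]: "p \<in> borel_measurable (Pi\<^sub>M {1..n} M)"
    and p_nonneg: "\<And>x. x \<in> space (Pi\<^sub>M {1..n} M) \<Longrightarrow> 0 \<le> p x"
    and prob_p: "prob_space (density (Pi\<^sub>M {1..n} M) (\<lambda>x. ennreal (p x)))"
    and cond: "cond_densities n M p c"
begin

abbreviation S :: "(nat \<Rightarrow> 'a) measure" where "S \<equiv> Pi\<^sub>M {1..n} M"

text \<open>\<open>upd B w x\<close> is \<open>x\<close> with the coordinates in \<open>B\<close> replaced by those of \<open>w\<close>.\<close>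

abbreviation upd :: "nat set \<Rightarrow> (nat \<Rightarrow> 'a) \<Rightarrow> (nat \<Rightarrow> 'a) \<Rightarrow> nat \<Rightarrow> 'a" where
  "upd B w x \<equiv> merge B ({1..n} - B) (w, x)"

text \<open>The law of the state after the coordinates in \<open>B\<close> of \<open>x\<close> have been redrawn from their
  conditional distribution given the others.  It is a measure on the full space, so that the
  same object serves as transition kernel (as a function of \<open>x\<close>) and, for fixed \<open>x\<close>, as the
  conditional distribution of the state given the coordinates of \<open>x\<close> outside \<open>B\<close>.\<close>

definition resample :: "nat set \<Rightarrow> (nat \<Rightarrow> 'a) \<Rightarrow> (nat \<Rightarrow> 'a) measure" where
  "resample B x = distr (cond_dist M c B ({1..n} - B) (restrict x ({1..n} - B))) S (\<lambda>w. upd B w x)"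

text \<open>The marginal density of the coordinates outside \<open>B\<close> at \<open>x\<close>; equivalently, the integral of
  \<open>p\<close> over the coordinates in \<open>B\<close>, taken to be \<open>0\<close> if that integral diverges.\<close>

definition mass :: "nat set \<Rightarrow> (nat \<Rightarrow> 'a) \<Rightarrow> real" where
  "mass B x = marginal n M p ({1..n} - B) (restrict x ({1..n} - B))"

text \<open>Extending the coordinate spaces by one-point spaces outside \<open>{1..n}\<close> makes the family
  \<open>\<sigma>\<close>-finite at every index and changes none of the products over subsets of \<open>{1..n}\<close>.\<close>

lemma product_sigma_finite_extend:
  "product_sigma_finite (\<lambda>i. if i \<in> {1..n} then M i else count_space {undefined})"
  unfolding product_sigma_finite_def
  using sigma_finite sigma_finite_measure_count_space_finite[of "{undefined}"] by auto

lemma PiM_extend: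
  "A \<subseteq> {1..n} \<Longrightarrow> Pi\<^sub>M A (\<lambda>i. if i \<in> {1..n} then M i else count_space {undefined}) = Pi\<^sub>M A M"
  by (intro PiM_cong) auto

lemma sigma_finite_PiM: "A \<subseteq> {1..n} \<Longrightarrow> sigma_finite_measure (Pi\<^sub>M A M)"
  using product_sigma_finite.sigma_finite[OF product_sigma_finite_extend, of A] PiM_extend[of A]
    finite_subset[of A "{1..n}"] by simp

lemma nn_integral_PiM_Un:
  assumes "I \<inter> J = {}" "I \<subseteq> {1..n}" "J \<subseteq> {1..n}" "f \<in> borel_measurable (Pi\<^sub>M (I \<union> J) M)"
  shows "(\<integral>\<^sup>+w. f w \<partial>Pi\<^sub>M (I \<union> J) M) = (\<integral>\<^sup>+u. (\<integral>\<^sup>+v. f (merge I J (u, v)) \<partial>Pi\<^sub>M J M) \<partial>Pi\<^sub>M I M)"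
  using product_sigma_finite.product_nn_integral_fold[OF product_sigma_finite_extend, of I J f]
    assms PiM_extend[of I] PiM_extend[of J] PiM_extend[of "I \<union> J"]
    finite_subset[of I "{1..n}"] finite_subset[of J "{1..n}"] by simp

lemma measurable_upd[measurable (raw)]:
  assumes B: "B \<subseteq> {1..n}" and [measurable]: "f \<in> N \<rightarrow>\<^sub>M Pi\<^sub>M B M" "g \<in> N \<rightarrow>\<^sub>M S"
  shows "(\<lambda>z. upd B (f z) (g z)) \<in> N \<rightarrow>\<^sub>M S"
proof -
  have "(\<lambda>z. merge B ({1..n} - B) (f z, restrict (g z) ({1..n} - B))) \<in> N \<rightarrow>\<^sub>M Pi\<^sub>M (B \<union> ({1..n} - B)) M"
    by (intro measurable_compose[OF _ measurable_merge] measurable_Pair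
        measurable_compose[OF _ measurable_restrict_subset[of _ "{1..n}"]]) measurable
  moreover have "B \<union> ({1..n} - B) = {1..n}" using B by auto
  ultimately show ?thesis by simp
qed

lemma space_upd:
  assumes "B \<subseteq> {1..n}" "w \<in> space (Pi\<^sub>M B M)" "x \<in> space S"
  shows "upd B w x \<in> space S"
  using measurable_space[OF measurable_upd[OF assms(1), of fst "Pi\<^sub>M B M \<Otimes>\<^sub>M S" snd], of "(w, x)"] assms
  by (simp add: space_pair_measure)

lemma restrict_upd: "restrict (upd B w x) ({1..n} - B) = restrict x ({1..n} - B)"
  by (simp add: fun_eq_iff merge_def)

lemma upd_upd: "upd B v (upd B w x) = upd B v x"
  by (simp add: fun_eq_iff merge_def)

lemma resample_upd: "resample B (upd B w x) = resample B x"
  unfolding resample_def restrict_upd upd_upd ..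

lemma mass_upd: "mass B (upd B w x) = mass B x"
  unfolding mass_def restrict_upd ..

lemma merge_swap: "merge ({1..n} - B) B (x, w) = upd B w x"
  by (rule merge_commute) auto

lemma mass_eq:
  assumes "B \<subseteq> {1..n}"
  shows "mass B x = (LINT w|Pi\<^sub>M B M. p (upd B w x))"
proof -
  have "{1..n} - ({1..n} - B) = B" using assms by auto
  then show ?thesis
    by (simp add: mass_def marginal_def merge_swap)
qed

lemma mass_nonneg: "B \<subseteq> {1..n} \<Longrightarrow> x \<in> space S \<Longrightarrow> 0 \<le> mass B x"
  by (simp add: mass_eq p_nonneg space_upd)

lemma measurable_mass[measurable]:
  assumes B: "B \<subseteq> {1..n}"
  shows "mass B \<in> borel_measurable S"
proof -
  interpret sigma_finite_measure "Pi\<^sub>M B M" by (rule sigma_finite_PiM[OF B])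
  show ?thesis unfolding mass_eq[OF B] using B by measurable
qed

lemma nn_integral_p_upd:
  assumes B: "B \<subseteq> {1..n}" and x: "x \<in> space S" and pos: "0 < mass B x"
  shows "(\<integral>\<^sup>+w. ennreal (p (upd B w x)) \<partial>Pi\<^sub>M B M) = ennreal (mass B x)"
proof -
  have "integrable (Pi\<^sub>M B M) (\<lambda>w. p (upd B w x))"
    using pos not_integrable_integral_eq[of "Pi\<^sub>M B M" "\<lambda>w. p (upd B w x)"] by (auto simp: mass_eq[OF B])
  then show ?thesis
    by (simp add: mass_eq[OF B] nn_integral_eq_integral p_nonneg space_upd[OF B] x)
qed

lemma mass_eq_enn2real:
  assumes B: "B \<subseteq> {1..n}" and x: "x \<in> space S"
  shows "mass B x = enn2real (\<integral>\<^sup>+w. ennreal (p (upd B w x)) \<partial>Pi\<^sub>M B M)"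
  unfolding mass_eq[OF B]
  by (intro integral_eq_nn_integral) (use B x in \<open>auto intro!: p_nonneg space_upd\<close>)

lemma measurable_c:
  assumes "B \<subseteq> {1..n}" "B \<noteq> {}"
  shows "(\<lambda>(x, w). c B ({1..n} - B) w (restrict x ({1..n} - B))) \<in> borel_measurable (S \<Otimes>\<^sub>M Pi\<^sub>M B M)"
proof -
  have [measurable]: "(\<lambda>(y, w). c B ({1..n} - B) w y) \<in>
      borel_measurable (Pi\<^sub>M ({1..n} - B) M \<Otimes>\<^sub>M Pi\<^sub>M B M)"
    using cond assms unfolding cond_densities_def by auto
  have "(\<lambda>xw. (case_prod (\<lambda>y w. c B ({1..n} - B) w y)) (restrict (fst xw) ({1..n} - B), snd xw)) \<in>
      borel_measurable (S \<Otimes>\<^sub>M Pi\<^sub>M B M)"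
    by (intro measurable_compose[OF _ \<open>(\<lambda>(y, w). c B ({1..n} - B) w y) \<in> _\<close>] measurable_Pair
        measurable_compose[OF _ measurable_restrict_subset[of _ "{1..n}"]]) measurable
  then show ?thesis by (simp add: case_prod_beta')
qed

lemma measurable_c_section:
  assumes "B \<subseteq> {1..n}" "B \<noteq> {}" "x \<in> space S"
  shows "(\<lambda>w. c B ({1..n} - B) w (restrict x ({1..n} - B))) \<in> borel_measurable (Pi\<^sub>M B M)"
  using measurable_compose[OF measurable_Pair1'[OF assms(3)] measurable_c[OF assms(1,2)]] by simp

lemma restrict_in_space: "x \<in> space S \<Longrightarrow> A \<subseteq> {1..n} \<Longrightarrow> restrict x A \<in> space (Pi\<^sub>M A M)"
  using measurable_space[OF measurable_restrict_subset] by blast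

lemma marginal_all:
  assumes x: "x \<in> space S" shows "marginal n M p {1..n} x = p x"
proof -
  have "merge {1..n} {} (x, \<lambda>_. undefined) = x"
    using x by (auto simp: fun_eq_iff merge_def space_PiM PiE_def extensional_def)
  then show ?thesis
    by (simp add: marginal_def PiM_empty lebesgue_integral_count_space_finite)
qed

lemma c_eq:
  assumes B: "B \<subseteq> {1..n}" "B \<noteq> {}" and x: "x \<in> space S" and pos: "0 < mass B x"
    and w: "w \<in> space (Pi\<^sub>M B M)"
  shows "c B ({1..n} - B) w (restrict x ({1..n} - B)) = p (upd B w x) / mass B x"
proof -
  have "c B ({1..n} - B) w (restrict x ({1..n} - B)) =
      marginal n M p (({1..n} - B) \<union> B) (merge ({1..n} - B) B (restrict x ({1..n} - B), w)) / mass B x"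
    using cond B pos w restrict_in_space[OF x, of "{1..n} - B"] 
    unfolding cond_densities_def mass_def by (auto simp: Int_Diff)
  also have "({1..n} - B) \<union> B = {1..n}" using B by auto
  also have "merge ({1..n} - B) B (restrict x ({1..n} - B), w) = upd B w x"
    by (simp add: merge_swap)
  also have "marginal n M p {1..n} (upd B w x) = p (upd B w x)"
    by (rule marginal_all[OF space_upd[OF B(1) w x]])
  finally show ?thesis .
qed

lemma prob_cond_dist:
  assumes B: "B \<subseteq> {1..n}" "B \<noteq> {}" and x: "x \<in> space S"
  shows "prob_space (cond_dist M c B ({1..n} - B) (restrict x ({1..n} - B)))"
proof (cases "0 < mass B x")
  case True
  have "(\<integral>\<^sup>+w. ennreal (c B ({1..n} - B) w (restrict x ({1..n} - B))) \<partial>Pi\<^sub>M B M) =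
      (\<integral>\<^sup>+w. ennreal (p (upd B w x)) / ennreal (mass B x) \<partial>Pi\<^sub>M B M)"
    using True by (intro nn_integral_cong) (simp add: c_eq B x divide_ennreal p_nonneg space_upd)
  also have "\<dots> = 1"
    using True B x by (simp add: nn_integral_divide nn_integral_p_upd)
  finally show ?thesis
    using measurable_c_section[OF B x]
    by (intro prob_spaceI) (simp add: cond_dist_def emeasure_density cong: nn_integral_cong)
next
  case False
  then have "prob_density (Pi\<^sub>M B M) (\<lambda>w. c B ({1..n} - B) w (restrict x ({1..n} - B)))"
    using cond B restrict_in_space[OF x, of "{1..n} - B"]
    unfolding cond_densities_def mass_def by (auto simp: Int_Diff)
  then show ?thesis by (simp add: prob_density_def cond_dist_def)
qed

lemma sets_cond_dist[simp, measurable_cong]: "sets (cond_dist M c B A y) = sets (Pi\<^sub>M B M)"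
  by (simp add: cond_dist_def)

lemma space_cond_dist[simp]: "space (cond_dist M c B A y) = space (Pi\<^sub>M B M)"
  by (simp add: cond_dist_def)

lemma sets_resample[simp, measurable_cong]: "sets (resample B x) = sets S"
  by (simp add: resample_def)

lemma space_resample[simp]: "space (resample B x) = space S"
  by (simp add: resample_def)

lemma measurable_resample_eq: "measurable (resample B x) = measurable S"
  by (intro ext measurable_cong_sets) simp_all

lemma measurable_cond_dist_eq: "measurable (cond_dist M c B A y) = measurable (Pi\<^sub>M B M)"
  by (intro ext measurable_cong_sets) simp_all

lemma measurable_upd_const:
  assumes "B \<subseteq> {1..n}" "x \<in> space S"
  shows "(\<lambda>w. upd B w x) \<in> cond_dist M c B A y \<rightarrow>\<^sub>M S"
  unfolding measurable_cond_dist_eq using assms by measurable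

lemma prob_resample:
  assumes B: "B \<subseteq> {1..n}" "B \<noteq> {}" and x: "x \<in> space S"
  shows "prob_space (resample B x)"
  unfolding resample_def
  using prob_space.prob_space_distr[OF prob_cond_dist[OF assms] measurable_upd_const[OF B(1) x]] .

lemma nn_integral_resample:
  assumes B: "B \<subseteq> {1..n}" "B \<noteq> {}" and x: "x \<in> space S" and f[measurable]: "f \<in> borel_measurable S"
  shows "(\<integral>\<^sup>+x'. f x' \<partial>resample B x) =
    (\<integral>\<^sup>+w. ennreal (c B ({1..n} - B) w (restrict x ({1..n} - B))) * f (upd B w x) \<partial>Pi\<^sub>M B M)"
proof -
  note measurable_c_section[OF B x, measurable]
  have "(\<lambda>w. f (upd B w x)) \<in> borel_measurable (Pi\<^sub>M B M)" using B x by measurable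
  then show ?thesis
    unfolding resample_def
    by (simp add: nn_integral_distr[OF measurable_upd_const[OF B(1) x]] f)
       (simp add: cond_dist_def nn_integral_density)
qed

lemma measurable_resample[measurable]:
  assumes B: "B \<subseteq> {1..n}" "B \<noteq> {}"
  shows "resample B \<in> S \<rightarrow>\<^sub>M prob_algebra S"
proof (intro measurable_prob_algebraI measurable_subprob_algebra)
  interpret sigma_finite_measure "Pi\<^sub>M B M" by (rule sigma_finite_PiM[OF B(1)])
  fix A assume A[measurable]: "A \<in> sets S"
  have [measurable]: "(\<lambda>(x, w). c B ({1..n} - B) w (restrict x ({1..n} - B))) \<in> borel_measurable (S \<Otimes>\<^sub>M Pi\<^sub>M B M)"
    by (rule measurable_c[OF B])
  have "(\<lambda>x. \<integral>\<^sup>+w. ennreal (c B ({1..n} - B) w (restrict x ({1..n} - B))) * indicator A (upd B w x) \<partial>Pi\<^sub>M B M) \<in>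
      borel_measurable S"
    using B(1) by measurable
  moreover have "emeasure (resample B x) A =
      (\<integral>\<^sup>+w. ennreal (c B ({1..n} - B) w (restrict x ({1..n} - B))) * indicator A (upd B w x) \<partial>Pi\<^sub>M B M)"
    if "x \<in> space S" for x
    using nn_integral_resample[OF B that, of "indicator A"] A by simp
  ultimately show "(\<lambda>x. emeasure (resample B x) A) \<in> borel_measurable S"
    by (simp cong: measurable_cong)
qed (simp_all add: prob_resample B prob_space_imp_subprob_space)

section \<open>Conditional laws given more coordinates\<close>

lemma upd_merge:
  assumes "B \<subseteq> A" "A \<subseteq> {1..n}"
  shows "upd A (merge (A - B) B (u, v)) x = upd B v (upd (A - B) u x)"
  using assms by (auto simp: fun_eq_iff merge_def)

lemma nn_integral_p_split:
  assumes A: "A \<subseteq> {1..n}" and B: "B \<subseteq> A" and x: "x \<in> space S"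
    and f[measurable]: "f \<in> borel_measurable S"
  shows "(\<integral>\<^sup>+w. f (upd A w x) \<partial>Pi\<^sub>M A M) =
    (\<integral>\<^sup>+u. (\<integral>\<^sup>+v. f (upd B v (upd (A - B) u x)) \<partial>Pi\<^sub>M B M) \<partial>Pi\<^sub>M (A - B) M)"
proof -
  have eq: "(A - B) \<union> B = A" using B by auto
  have "(\<lambda>w. f (upd A w x)) \<in> borel_measurable (Pi\<^sub>M A M)" using A x by measurable
  with nn_integral_PiM_Un[of "A - B" B "\<lambda>w. f (upd A w x)"] A B show ?thesis
    unfolding eq upd_merge[OF B A] by (simp add: Diff_subset_conv le_supI2 Int_commute)
qed

text \<open>The law of the redrawn coordinates in \<open>A\<close>, with the coordinates in \<open>B \<subseteq> A\<close> integrated last.\<close>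

lemma nn_integral_resample_split:
  assumes A: "A \<subseteq> {1..n}" "A \<noteq> {}" and B: "B \<subseteq> A" and x: "x \<in> space S" and pos: "0 < mass A x"
    and f[measurable]: "f \<in> borel_measurable S"
  shows "(\<integral>\<^sup>+x'. f x' \<partial>resample A x) =
    (\<integral>\<^sup>+u. (\<integral>\<^sup>+v. ennreal (p (upd B v (upd (A - B) u x))) * f (upd B v (upd (A - B) u x)) \<partial>Pi\<^sub>M B M)
      \<partial>Pi\<^sub>M (A - B) M) / ennreal (mass A x)"
proof -
  have [measurable]: "(\<lambda>w. ennreal (p (upd A w x)) * f (upd A w x)) \<in> borel_measurable (Pi\<^sub>M A M)"
    using A x by measurable
  have "(\<integral>\<^sup>+x'. f x' \<partial>resample A x) =
      (\<integral>\<^sup>+w. ennreal (p (upd A w x)) * f (upd A w x) / ennreal (mass A x) \<partial>Pi\<^sub>M A M)"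
    unfolding nn_integral_resample[OF A x f]
    using pos by (intro nn_integral_cong)
      (simp add: c_eq[OF A x] divide_ennreal[symmetric] p_nonneg space_upd A x ennreal_times_divide mult.commute)
  also have "\<dots> = (\<integral>\<^sup>+w. ennreal (p (upd A w x)) * f (upd A w x) \<partial>Pi\<^sub>M A M) / ennreal (mass A x)"
    using pos by (simp add: nn_integral_divide)
  also have "(\<integral>\<^sup>+w. ennreal (p (upd A w x)) * f (upd A w x) \<partial>Pi\<^sub>M A M) =
      (\<integral>\<^sup>+u. (\<integral>\<^sup>+v. ennreal (p (upd B v (upd (A - B) u x))) * f (upd B v (upd (A - B) u x)) \<partial>Pi\<^sub>M B M)
      \<partial>Pi\<^sub>M (A - B) M)"
    by (rule nn_integral_p_split[OF A(1) B x, of "\<lambda>x. ennreal (p x) * f x"]) measurable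
  finally show ?thesis .
qed

text \<open>The integral of \<open>p\<close> over the coordinates in \<open>A\<close> is finite, hence so is almost every inner
  integral over the coordinates in \<open>B\<close>.  This excludes the points where \<open>mass B\<close> vanishes by
  divergence.\<close>

lemma AE_finite_inner:
  assumes A: "A \<subseteq> {1..n}" and B: "B \<subseteq> A" and x: "x \<in> space S" and pos: "0 < mass A x"
  shows "AE u in Pi\<^sub>M (A - B) M. (\<integral>\<^sup>+v. ennreal (p (upd B v (upd (A - B) u x))) \<partial>Pi\<^sub>M B M) \<noteq> \<infinity>"
proof (rule nn_integral_PInf_AE)
  have B': "B \<subseteq> {1..n}" using A B by auto
  have C: "A - B \<subseteq> {1..n}" using A by auto
  interpret sigma_finite_measure "Pi\<^sub>M B M" by (rule sigma_finite_PiM[OF B'])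
  show "(\<lambda>u. \<integral>\<^sup>+v. ennreal (p (upd B v (upd (A - B) u x))) \<partial>Pi\<^sub>M B M) \<in> borel_measurable (Pi\<^sub>M (A - B) M)"
    using B' C x by measurable
  show "(\<integral>\<^sup>+u. \<integral>\<^sup>+v. ennreal (p (upd B v (upd (A - B) u x))) \<partial>Pi\<^sub>M B M \<partial>Pi\<^sub>M (A - B) M) \<noteq> \<infinity>"
    using nn_integral_p_split[OF A B x, of "\<lambda>x. ennreal (p x)"] nn_integral_p_upd[OF A x pos]
    by (metis (no_types, lifting) ennreal_neq_top infinity_ennreal_def measurable_compose[OF p_measurable measurable_ennreal])
qed

text \<open>Starting from a point of positive marginal density, redrawing \<open>A\<close> almost surely leads to points at
  which the conditional densities of \<open>B\<close> are determined by \<open>p\<close> rather than arbitrary.\<close>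

lemma AE_mass_pos:
  assumes A: "A \<subseteq> {1..n}" "A \<noteq> {}" and B: "B \<subseteq> A" and x: "x \<in> space S" and pos: "0 < mass A x"
  shows "AE x' in resample A x. 0 < mass B x'"
proof -
  have B': "B \<subseteq> {1..n}" using A B by auto
  have C: "A - B \<subseteq> {1..n}" using A by auto
  note measurable_mass[OF B', measurable]
  have "(\<integral>\<^sup>+x'. indicator {x'\<in>space S. mass B x' \<le> 0} x' \<partial>resample A x) =
    (\<integral>\<^sup>+u. (\<integral>\<^sup>+v. ennreal (p (upd B v (upd (A - B) u x))) *
        indicator {x'\<in>space S. mass B x' \<le> 0} (upd B v (upd (A - B) u x)) \<partial>Pi\<^sub>M B M)
      \<partial>Pi\<^sub>M (A - B) M) / ennreal (mass A x)"
    by (rule nn_integral_resample_split[OF A B x pos]) measurable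
  also have "\<dots> = (\<integral>\<^sup>+u. 0 \<partial>Pi\<^sub>M (A - B) M) / ennreal (mass A x)"
  proof (intro arg_cong2[where f="(/)"] refl nn_integral_cong_AE)
    show "AE u in Pi\<^sub>M (A - B) M. (\<integral>\<^sup>+v. ennreal (p (upd B v (upd (A - B) u x))) *
        indicator {x'\<in>space S. mass B x' \<le> 0} (upd B v (upd (A - B) u x)) \<partial>Pi\<^sub>M B M) = 0"
      using AE_finite_inner[OF A(1) B x pos] AE_space
    proof eventually_elim
      case (elim u)
      define x' where "x' = upd (A - B) u x"
      have x': "x' \<in> space S" unfolding x'_def using C elim(2) x by (rule space_upd)
      show ?case
      proof (cases "mass B x' \<le> 0")
        case True
        then have "mass B x' = 0" using mass_nonneg[OF B' x'] by simp
        then have "(\<integral>\<^sup>+v. ennreal (p (upd B v x')) \<partial>Pi\<^sub>M B M) = 0"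
          using mass_eq_enn2real[OF B' x'] elim(1)
          by (auto simp: enn2real_eq_0_iff x'_def[symmetric])
        then show ?thesis
          unfolding x'_def[symmetric] using B' x' by (intro nn_integral_mult_0) measurable
      next
        case False
        then show ?thesis by (simp add: mass_upd x'_def[symmetric])
      qed
    qed
  qed
  finally have "emeasure (resample A x) {x'\<in>space S. mass B x' \<le> 0} = 0" by simp
  then show ?thesis
    by (intro AE_I[where N="{x'\<in>space S. mass B x' \<le> 0}"]) (auto simp: not_less)
qed

text \<open>The tower property: redrawing \<open>B\<close> does not change the conditional law of the larger block
  \<open>A\<close>.\<close>

lemma nn_integral_resample_tower:
  assumes A: "A \<subseteq> {1..n}" "A \<noteq> {}" and B: "B \<subseteq> A" "B \<noteq> {}" and x: "x \<in> space S" and pos: "0 < mass A x"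
    and f[measurable]: "f \<in> borel_measurable S"
  shows "(\<integral>\<^sup>+x'. (\<integral>\<^sup>+x''. f x'' \<partial>resample B x') \<partial>resample A x) = (\<integral>\<^sup>+x'. f x' \<partial>resample A x)"
proof -
  have B': "B \<subseteq> {1..n}" using A B by auto
  have C: "A - B \<subseteq> {1..n}" using A by auto
  note measurable_prob_algebraD[OF measurable_resample[OF B' B(2)], measurable]
  have [measurable]: "(\<lambda>x'. \<integral>\<^sup>+x''. f x'' \<partial>resample B x') \<in> borel_measurable S" by measurable
  have "(\<integral>\<^sup>+x'. (\<integral>\<^sup>+x''. f x'' \<partial>resample B x') \<partial>resample A x) =
    (\<integral>\<^sup>+u. (\<integral>\<^sup>+v. ennreal (p (upd B v (upd (A - B) u x))) *
        (\<integral>\<^sup>+x''. f x'' \<partial>resample B (upd B v (upd (A - B) u x))) \<partial>Pi\<^sub>M B M)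
      \<partial>Pi\<^sub>M (A - B) M) / ennreal (mass A x)"
    by (rule nn_integral_resample_split[OF A B(1) x pos]) measurable
  also have "\<dots> = (\<integral>\<^sup>+u. (\<integral>\<^sup>+v. ennreal (p (upd B v (upd (A - B) u x))) *
        f (upd B v (upd (A - B) u x)) \<partial>Pi\<^sub>M B M) \<partial>Pi\<^sub>M (A - B) M) / ennreal (mass A x)"
  proof (intro arg_cong2[where f="(/)"] refl nn_integral_cong_AE)
    show "AE u in Pi\<^sub>M (A - B) M. (\<integral>\<^sup>+v. ennreal (p (upd B v (upd (A - B) u x))) *
        (\<integral>\<^sup>+x''. f x'' \<partial>resample B (upd B v (upd (A - B) u x))) \<partial>Pi\<^sub>M B M) =
      (\<integral>\<^sup>+v. ennreal (p (upd B v (upd (A - B) u x))) * f (upd B v (upd (A - B) u x)) \<partial>Pi\<^sub>M B M)"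
      using AE_finite_inner[OF A(1) B(1) x pos] AE_space
    proof eventually_elim
      case (elim u)
      define x' where "x' = upd (A - B) u x"
      have x': "x' \<in> space S" unfolding x'_def using C elim(2) x by (rule space_upd)
      have [measurable]: "(\<lambda>v. ennreal (p (upd B v x'))) \<in> borel_measurable (Pi\<^sub>M B M)"
        "(\<lambda>v. f (upd B v x')) \<in> borel_measurable (Pi\<^sub>M B M)"
        using B' x' by measurable
      define h where "h = (\<integral>\<^sup>+v. ennreal (p (upd B v x')) \<partial>Pi\<^sub>M B M)"
      have "(\<integral>\<^sup>+v. ennreal (p (upd B v x')) * (\<integral>\<^sup>+x''. f x'' \<partial>resample B x') \<partial>Pi\<^sub>M B M) =
          h * (\<integral>\<^sup>+x''. f x'' \<partial>resample B x')"
        unfolding h_def by (rule nn_integral_multc) measurable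
      also have "\<dots> = (\<integral>\<^sup>+v. ennreal (p (upd B v x')) * f (upd B v x') \<partial>Pi\<^sub>M B M)"
      proof (cases "mass B x' > 0")
        case True
        have h: "h = ennreal (mass B x')" unfolding h_def by (rule nn_integral_p_upd[OF B' x' True])
        have "(\<integral>\<^sup>+x''. f x'' \<partial>resample B x') =
            (\<integral>\<^sup>+v. ennreal (p (upd B v x')) * f (upd B v x') / ennreal (mass B x') \<partial>Pi\<^sub>M B M)"
          unfolding nn_integral_resample[OF B' B(2) x' f]
          using True by (intro nn_integral_cong)
            (simp add: c_eq[OF B' B(2) x'] divide_ennreal[symmetric] p_nonneg space_upd B' x'
              ennreal_times_divide mult.commute)
        also have "\<dots> = (\<integral>\<^sup>+v. ennreal (p (upd B v x')) * f (upd B v x') \<partial>Pi\<^sub>M B M) / h"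
          by (simp add: h nn_integral_divide)
        finally show ?thesis
          using True by (simp add: h ennreal_times_divide mult_divide_eq_ennreal mult.commute[of "ennreal (mass B x')"])
      next
        case False
        then have "mass B x' = 0" using mass_nonneg[OF B' x'] by simp
        then have "h = 0"
          using mass_eq_enn2real[OF B' x'] elim(1)
          by (auto simp: enn2real_eq_0_iff x'_def[symmetric] h_def)
        then show ?thesis
          by (simp add: h_def nn_integral_mult_0)
      qed
      finally show ?case by (simp add: resample_upd x'_def)
    qed
  qed
  also have "\<dots> = (\<integral>\<^sup>+x'. f x' \<partial>resample A x)"
    by (rule nn_integral_resample_split[OF A B(1) x pos f, symmetric])
  finally show ?thesis .
qed

lemma resampling_resample:
  assumes A: "A \<subseteq> {1..n}" "A \<noteq> {}" and B: "B \<subseteq> A" "B \<noteq> {}" and x: "x \<in> space S" and pos: "0 < mass A x"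
  shows "resampling (resample A x) (resample B)"
proof -
  have B': "B \<subseteq> {1..n}" using A B by auto
  have eq: "prob_algebra (resample A x) = prob_algebra S"
    by (simp add: prob_algebra_def subprob_algebra_cong[OF sets_resample])
  have sub: "resample B \<in> S \<rightarrow>\<^sub>M subprob_algebra S"
    by (rule measurable_prob_algebraD[OF measurable_resample[OF B' B(2)]])
  interpret prob_space "resample A x" by (rule prob_resample[OF A x])
  show ?thesis
  proof
    show "resample B \<in> resample A x \<rightarrow>\<^sub>M prob_algebra (resample A x)"
      unfolding eq measurable_resample_eq by (rule measurable_resample[OF B' B(2)])
    show "resample A x \<bind> resample B = resample A x"
    proof (rule measure_eqI)
      show *: "sets (resample A x \<bind> resample B) = sets (resample A x)"
        using not_empty by (subst sets_bind[where N=S]) auto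
      fix Z assume "Z \<in> sets (resample A x \<bind> resample B)"
      then have Z[measurable]: "Z \<in> sets S" using * by simp
      have "emeasure (resample A x \<bind> resample B) Z = (\<integral>\<^sup>+x'. emeasure (resample B x') Z \<partial>resample A x)"
        using not_empty by (intro emeasure_bind[where N=S] Z) (simp_all add: measurable_resample_eq sub)
      also have "\<dots> = emeasure (resample A x) Z"
        using nn_integral_resample_tower[OF A B x pos, of "indicator Z"] Z by simp
      finally show "emeasure (resample A x \<bind> resample B) Z = emeasure (resample A x) Z" .
    qed
    fix f :: "(nat \<Rightarrow> 'a) \<Rightarrow> real" and x' assume f: "f \<in> borel_measurable (resample A x)" and x': "x' \<in> space (resample A x)"
    note sub[measurable]
    have [measurable]: "f \<in> borel_measurable S" using f by (simp add: measurable_resample_eq)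
    have [measurable]: "kernel_op (resample B) f \<in> borel_measurable S"
      unfolding kernel_op_def by measurable
    have "AE x'' in resample B x'. kernel_op (resample B) f x'' = kernel_op (resample B) f x'"
      unfolding resample_def[of B x']
      by (subst AE_distr_iff[OF measurable_upd_const]) (use B' x' in \<open>auto simp: kernel_op_def resample_upd\<close>)
    then show "AE x'' in resample B x'. kernel_op (resample B) f x'' = kernel_op (resample B) f x'" .
  qed
qed

lemma diff_diff_E: "A \<subseteq> {1..n} \<Longrightarrow> {1..n} - ({1..n} - A) = A"
  by (simp add: double_diff)

text \<open>Hence the suprema over conditioning points run over nonempty sets.\<close>

lemma exists_mass_pos:
  assumes A: "A \<subseteq> {1..n}" and n: "1 \<le> n"
  shows "\<exists>x\<in>space S. 0 < mass A x"
proof -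
  interpret D: prob_space "density S (\<lambda>x. ennreal (p x))" by (rule prob_p)
  obtain x where x: "x \<in> space S" using D.not_empty by (auto simp del: space_PiM_empty_iff)
  have "upd {1..n} w x = w" if "w \<in> space S" for w
    using that by (auto simp: fun_eq_iff merge_def space_PiM PiE_def extensional_def)
  then have "mass {1..n} x = enn2real (\<integral>\<^sup>+w. ennreal (p w) \<partial>S)"
    using x by (simp add: mass_eq_enn2real cong: nn_integral_cong)
  also have "(\<integral>\<^sup>+w. ennreal (p w) \<partial>S) = 1"
    using D.emeasure_space_1 by (simp add: emeasure_density cong: nn_integral_cong)
  finally have pos: "0 < mass {1..n} x" by simp
  have ne: "{1..n} \<noteq> {}" using n by simp
  interpret R: prob_space "resample {1..n} x" by (rule prob_resample[OF order_refl ne x])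
  show ?thesis
  proof (rule ccontr)
    assume none: "\<not> (\<exists>x\<in>space S. 0 < mass A x)"
    have "AE x' in resample {1..n} x. False"
      using AE_mass_pos[OF order_refl ne A x pos] AE_space
      by eventually_elim (use none in simp)
    then show False by (simp only: R.AE_False)
  qed
qed

text \<open>Every admissible conditioning point of a Gibbs sampler is the restriction of a full state.\<close>

lemma mass_complement:
  assumes L: "\<Lambda> \<subseteq> {1..n}" and y: "y \<in> space (Pi\<^sub>M \<Lambda> M)" and pos: "0 < marginal n M p \<Lambda> y"
  obtains x where "x \<in> space S" "restrict x \<Lambda> = y" "0 < mass ({1..n} - \<Lambda>) x"
proof -
  have ne: "space (Pi\<^sub>M ({1..n} - \<Lambda>) M) \<noteq> {}"
  proof
    assume empty: "space (Pi\<^sub>M ({1..n} - \<Lambda>) M) = {}"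
    have "marginal n M p \<Lambda> y = (LINT z|Pi\<^sub>M ({1..n} - \<Lambda>) M. 0)"
      unfolding marginal_def by (intro Bochner_Integration.integral_cong refl) (use empty in blast)
    then show False using pos by simp
  qed
  then obtain z where z: "z \<in> space (Pi\<^sub>M ({1..n} - \<Lambda>) M)" by blast
  have "merge \<Lambda> ({1..n} - \<Lambda>) (y, z) \<in> space (Pi\<^sub>M (\<Lambda> \<union> ({1..n} - \<Lambda>)) M)"
    using y z by (intro measurable_space[OF measurable_merge]) (simp add: space_pair_measure)
  moreover have "\<Lambda> \<union> ({1..n} - \<Lambda>) = {1..n}" using L by auto
  ultimately have x: "merge \<Lambda> ({1..n} - \<Lambda>) (y, z) \<in> space S" by simp
  have r: "restrict (merge \<Lambda> ({1..n} - \<Lambda>) (y, z)) \<Lambda> = y"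
    using y by (auto simp: fun_eq_iff space_PiM PiE_def extensional_def merge_def)
  show ?thesis
    using that[OF x r] pos unfolding mass_def diff_diff_E[OF L] r .
qed

lemma mass_pos_marginal:
  assumes "x \<in> space S" "0 < mass A x"
  shows "restrict x ({1..n} - A) \<in> {y \<in> space (Pi\<^sub>M ({1..n} - A) M). 0 < marginal n M p ({1..n} - A) y}"
  using restrict_in_space[OF assms(1), of "{1..n} - A"] assms(2) unfolding mass_def by blast

lemma integral_resample:
  fixes f :: "(nat \<Rightarrow> 'a) \<Rightarrow> real"
  assumes A: "A \<subseteq> {1..n}" and x: "x \<in> space S" and f: "f \<in> borel_measurable S"
  shows "(LINT x'|resample A x. f x') =
      (LINT w|cond_dist M c A ({1..n} - A) (restrict x ({1..n} - A)). f (upd A w x))"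
    "integrable (resample A x) f \<longleftrightarrow>
      integrable (cond_dist M c A ({1..n} - A) (restrict x ({1..n} - A))) (\<lambda>w. f (upd A w x))"
  unfolding resample_def
  by (rule integral_distr[OF measurable_upd_const[OF A x] f] integrable_distr_eq[OF measurable_upd_const[OF A x] f])+

lemma measurable_kernel_op_resample:
  fixes f :: "(nat \<Rightarrow> 'a) \<Rightarrow> real"
  assumes "B \<subseteq> {1..n}" "B \<noteq> {}" "f \<in> borel_measurable S"
  shows "kernel_op (resample B) f \<in> borel_measurable S"
  unfolding kernel_op_def
  using measurable_prob_algebraD[OF measurable_resample[OF assms(1,2)]] assms(3)
  by (intro measurable_compose[OF _ integral_measurable_subprob_algebra])

section \<open>Conditional correlation coefficients\<close>

text \<open>The maximal correlation coefficient \<open>S(m)\<close> as a real number.\<close>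

definition corr_coeff :: "nat \<Rightarrow> real" where "corr_coeff m = real_of_ereal (max_corr n M p c m)"

lemma corr_le_1:
  assumes "\<Lambda> \<subseteq> {1..n}"
  shows "corr n M c \<Lambda> y \<le> 1"
  unfolding corr_def
  by (rule s_star_le_1) (auto simp: measurable_cond_dist_eq)

lemma finite_nonempty_subsets:
  assumes "k \<le> n" shows "finite {\<Lambda>. \<Lambda> \<subseteq> {1..n} \<and> card \<Lambda> = k}" "{\<Lambda>. \<Lambda> \<subseteq> {1..n} \<and> card \<Lambda> = k} \<noteq> {}"
  using obtain_subset_with_card_n[of k "{1..n}"] assms by (auto intro: finite_subset[of _ "Pow {1..n}"])

lemma max_corr_eq_corr_coeff:
  assumes m: "1 \<le> m" "m \<le> n"
  shows "max_corr n M p c m = ereal (corr_coeff m)" "0 \<le> corr_coeff m" "corr_coeff m \<le> 1"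
proof -
  note fin = finite_nonempty_subsets[of "n - m"]
  have le: "max_corr n M p c m \<le> 1"
    unfolding max_corr_def using fin by (auto intro!: SUP_least corr_le_1)
  obtain A where A: "A \<subseteq> {1..n}" "card A = m"
    using obtain_subset_with_card_n[of m "{1..n}"] m by auto
  obtain x where x: "x \<in> space S" "0 < mass A x"
    using exists_mass_pos[OF A(1)] m by auto
  have "0 \<le> corr n M c ({1..n} - A) (restrict x ({1..n} - A))"
    unfolding corr_def by (rule s_star_nonneg)
  also have "\<dots> \<le> (SUP y\<in>{y \<in> space (Pi\<^sub>M ({1..n} - A) M). 0 < marginal n M p ({1..n} - A) y}. corr n M c ({1..n} - A) y)"
    by (rule SUP_upper[OF mass_pos_marginal[OF x]])
  also have "\<dots> \<le> max_corr n M p c m"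
    unfolding max_corr_def using fin A by (intro Max_ge finite_imageI imageI) (auto simp: card_Diff_subset finite_subset)
  finally have ge: "0 \<le> max_corr n M p c m" .
  show "max_corr n M p c m = ereal (corr_coeff m)" "0 \<le> corr_coeff m" "corr_coeff m \<le> 1"
    using le ge by (cases "max_corr n M p c m"; simp add: corr_coeff_def)+
qed

lemma corr_le_corr_coeff:
  assumes A: "A \<subseteq> {1..n}" "A \<noteq> {}" and x: "x \<in> space S" "0 < mass A x"
  shows "corr n M c ({1..n} - A) (restrict x ({1..n} - A)) \<le> ereal (corr_coeff (card A))"
proof -
  note fin = finite_nonempty_subsets[of "n - card A"]
  have A': "finite A" using A finite_subset by auto
  have "card A \<le> n" using card_mono[OF _ A(1)] by simp
  then have eq: "ereal (corr_coeff (card A)) = max_corr n M p c (card A)"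
    using max_corr_eq_corr_coeff[of "card A"] A A' by (simp add: Suc_le_eq card_gt_0_iff One_nat_def)
  have "corr n M c ({1..n} - A) (restrict x ({1..n} - A)) \<le>
      (SUP y\<in>{y \<in> space (Pi\<^sub>M ({1..n} - A) M). 0 < marginal n M p ({1..n} - A) y}. corr n M c ({1..n} - A) y)"
    by (rule SUP_upper[OF mass_pos_marginal[OF x]])
  also have "\<dots> \<le> max_corr n M p c (card A)"
    unfolding max_corr_def using fin A A'
    by (intro Max_ge finite_imageI imageI) (auto simp: card_Diff_subset)
  finally show ?thesis unfolding eq .
qed

lemma upd_remove:
  assumes "A \<subseteq> {1..n}" "i \<in> A"
  shows "upd A w x = upd (A - {i}) w (x(i := w i))"
  using assms by (auto simp: fun_eq_iff merge_def)

text \<open>Redrawing all coordinates in \<open>A\<close> except the \<open>i\<close>-th leaves a function \<open>\<phi> i\<close> of the \<open>i\<close>-th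
  coordinate; these functions are admissible in the definition of the correlation coefficient.\<close>

lemma corr_projections_le:
  fixes f :: "(nat \<Rightarrow> 'a) \<Rightarrow> real"
  assumes A: "A \<subseteq> {1..n}" "2 \<le> card A" and x: "x \<in> space S" "0 < mass A x"
    and f: "f \<in> L20 (resample A x)"
  shows "(LINT x'|resample A x. (\<Sum>i\<in>A. kernel_op (resample (A - {i})) f x')\<^sup>2) \<le>
    (card A * corr_coeff (card A)) * (\<Sum>i\<in>A. LINT x'|resample A x. (kernel_op (resample (A - {i})) f x')\<^sup>2)"
proof -
  define \<nu> where "\<nu> = cond_dist M c A ({1..n} - A) (restrict x ({1..n} - A))"
  define Q where "Q = (\<lambda>i. kernel_op (resample (A - {i})) f)"
  define \<phi> where "\<phi> = (\<lambda>i a. Q i (x(i := a)))"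
  have A_ne: "A \<noteq> {}" and A_fin: "finite A" using A by (auto intro: finite_subset)
  have B: "A - {i} \<subseteq> A" "A - {i} \<subseteq> {1..n}" "A - {i} \<noteq> {}" for i
  proof -
    show "A - {i} \<noteq> {}"
      using A(2) card_mono[of "{i}" A] by auto
  qed (use A in auto)
  have fS: "f \<in> borel_measurable S" and f2: "integrable (resample A x) (\<lambda>x. (f x)\<^sup>2)"
    and f0: "(LINT x'|resample A x. f x') = 0"
    using f by (auto simp: L20_def measurable_resample_eq)
  have fR: "f \<in> borel_measurable (resample A x)" using fS by (simp add: measurable_resample_eq)
  note res = resampling_resample[OF A(1) A_ne B(1) B(3) x]
  have Q[measurable]: "Q i \<in> borel_measurable S" for i
    unfolding Q_def by (rule measurable_kernel_op_resample[OF B(2,3) fS])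
  have Q_upd: "Q i (upd A w x) = \<phi> i (w i)" if "i \<in> A" for i w
    unfolding \<phi>_def upd_remove[OF A(1) that] Q_def by (simp add: kernel_op_def resample_upd)
  have \<phi>[measurable]: "\<phi> i \<in> borel_measurable (M i)" if "i \<in> A" for i
  proof -
    have "(\<lambda>a. x(i := a)) \<in> M i \<rightarrow>\<^sub>M S"
      by (rule measurable_fun_upd[where J="{1..n}"]) (use that A x in auto)
    then show ?thesis unfolding \<phi>_def by (rule measurable_compose[OF _ Q])
  qed
  have proj: "(\<lambda>z. z i) \<in> \<nu> \<rightarrow>\<^sub>M M i" if "i \<in> A" for i
    unfolding \<nu>_def measurable_cond_dist_eq using that by measurable
  have L: "\<phi> i \<in> L20 (distr \<nu> (M i) (\<lambda>z. z i))" if i: "i \<in> A" for i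
  proof -
    interpret prob_space "resample A x" by (rule prob_resample[OF A(1) A_ne x(1)])
    have "integrable (resample A x) (\<lambda>x'. (Q i x')\<^sup>2)"
      unfolding Q_def by (rule resampling.square_integrable_kernel_op[OF res fR f2])
    then have 1: "integrable \<nu> (\<lambda>w. (\<phi> i (w i))\<^sup>2)"
      by (subst (asm) integral_resample(2)[OF A(1) x(1)]) (simp_all add: Q_upd[OF i] \<nu>_def)
    have "(LINT x'|resample A x. Q i x') = 0"
      unfolding Q_def
      using resampling.integral_kernel_op(2)[OF res square_integrable_imp_integrable[OF fR f2]] f0 by simp
    then have 2: "(LINT w|\<nu>. \<phi> i (w i)) = 0"
      by (subst (asm) integral_resample(1)[OF A(1) x(1)]) (simp_all add: Q_upd[OF i] \<nu>_def)
    show ?thesis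
      using 1 2 \<phi>[OF i] proj[OF i] by (simp add: L20_def integrable_distr_eq integral_distr)
  qed
  have "s_star \<nu> A M (\<lambda>i z. z i) \<le> ereal (corr_coeff (card A))"
    using corr_le_corr_coeff[OF A(1) A_ne x] unfolding corr_def diff_diff_E[OF A(1)] \<nu>_def .
  from integral_sum_sq_le_s_star[OF A_fin proj L this]
  have "(LINT w|\<nu>. (\<Sum>i\<in>A. \<phi> i (w i))\<^sup>2) \<le> (card A * corr_coeff (card A)) * (\<Sum>i\<in>A. LINT w|\<nu>. (\<phi> i (w i))\<^sup>2)" .
  also have "(LINT w|\<nu>. (\<Sum>i\<in>A. \<phi> i (w i))\<^sup>2) = (LINT x'|resample A x. (\<Sum>i\<in>A. Q i x')\<^sup>2)"
    by (subst integral_resample(1)[OF A(1) x(1)]) (simp_all add: Q_upd \<nu>_def)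
  also have "(\<Sum>i\<in>A. LINT w|\<nu>. (\<phi> i (w i))\<^sup>2) = (\<Sum>i\<in>A. LINT x'|resample A x. (Q i x')\<^sup>2)"
    by (intro sum.cong refl, subst integral_resample(1)[OF A(1) x(1)]) (simp_all add: Q_upd \<nu>_def)
  finally show ?thesis unfolding Q_def .
qed

text \<open>The quadratic form of the Gibbs sampler on \<open>A\<close> with block size \<open>card A - 1\<close>.  The value
  \<open>kernel_op (resample A) f x\<close> is the mean of \<open>f\<close>.\<close>

lemma one_coordinate_step:
  fixes f :: "(nat \<Rightarrow> 'a) \<Rightarrow> real"
  assumes A: "A \<subseteq> {1..n}" "2 \<le> card A" and x: "x \<in> space S" "0 < mass A x"
    and f: "f \<in> borel_measurable S" and f2: "integrable (resample A x) (\<lambda>x. (f x)\<^sup>2)"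
  shows "(\<Sum>i\<in>A. LINT x'|resample A x. (kernel_op (resample (A - {i})) f x')\<^sup>2) / card A \<le>
    corr_coeff (card A) * (LINT x'|resample A x. (f x')\<^sup>2) + (1 - corr_coeff (card A)) * (kernel_op (resample A) f x)\<^sup>2"
proof -
  have A_ne: "A \<noteq> {}" and A_fin: "finite A" using A by (auto intro: finite_subset)
  have card: "card A \<le> n" using card_mono[OF _ A(1)] by simp
  interpret prob_space "resample A x" by (rule prob_resample[OF A(1) A_ne x(1)])
  have B: "A - {i} \<subseteq> A" "A - {i} \<noteq> {}" for i
    using A(2) card_mono[of "{i}" A] by auto
  note res = resampling_resample[OF A(1) A_ne B x]
  have fR: "f \<in> borel_measurable (resample A x)" using f by (simp add: measurable_resample_eq)
  have f1: "integrable (resample A x) f" by (rule square_integrable_imp_integrable[OF fR f2])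
  define e where "e = expectation f"
  have e: "kernel_op (resample A) f x = e" by (simp add: kernel_op_def e_def)
  have gR: "(\<lambda>x. f x - e) \<in> borel_measurable (resample A x)" using fR by simp
  have g2: "integrable (resample A x) (\<lambda>x. (f x - e)\<^sup>2)"
    using f1 f2 by (simp add: power2_diff)
  have gL: "(\<lambda>x. f x - e) \<in> L20 (resample A x)"
    using gR g2 f1 by (simp add: L20_def e_def prob_space[unfolded space_resample])
  have nn: "0 \<le> card A * corr_coeff (card A)"
    using max_corr_eq_corr_coeff(2)[of "card A"] A card by simp
  have "(\<Sum>i\<in>A. LINT x'|resample A x. (kernel_op (resample (A - {i})) (\<lambda>x. f x - e) x')\<^sup>2) \<le>
      (card A * corr_coeff (card A)) * (LINT x'|resample A x. (f x' - e)\<^sup>2)"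
    by (rule sum_kernel_op_sq_le[OF A_fin res gR g2 corr_projections_le[OF A x gL] nn])
  also have "(LINT x'|resample A x. (f x' - e)\<^sup>2) = (LINT x'|resample A x. (f x')\<^sup>2) - e\<^sup>2"
    using variance_eq[OF f1 f2] by (simp add: e_def)
  also have "(\<Sum>i\<in>A. LINT x'|resample A x. (kernel_op (resample (A - {i})) (\<lambda>x. f x - e) x')\<^sup>2) =
      (\<Sum>i\<in>A. (LINT x'|resample A x. (kernel_op (resample (A - {i})) f x')\<^sup>2) - e\<^sup>2)"
    unfolding e_def by (intro sum.cong refl resampling.kernel_op_sq_diff_const[OF res fR f2])
  also have "\<dots> = (\<Sum>i\<in>A. LINT x'|resample A x. (kernel_op (resample (A - {i})) f x')\<^sup>2) - card A * e\<^sup>2"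
    by (simp add: sum_subtractf)
  finally have "(\<Sum>i\<in>A. LINT x'|resample A x. (kernel_op (resample (A - {i})) f x')\<^sup>2) \<le>
      (corr_coeff (card A) * (LINT x'|resample A x. (f x')\<^sup>2) + (1 - corr_coeff (card A)) * e\<^sup>2) * card A"
    by (simp add: algebra_simps)
  then show ?thesis
    using A(2) by (subst pos_divide_le_eq) (auto simp: e)
qed

section \<open>The recursion over block sizes\<close>

text \<open>The lower bound for the spectral gap with \<open>m\<close> free coordinates and block size \<open>l\<close>.  For
  \<open>m = l\<close> the product is empty: the sampler then draws independently from its target.\<close>

definition gap_bound :: "nat \<Rightarrow> nat \<Rightarrow> real" where "gap_bound l m = (\<Prod>k = l + 1..m. 1 - corr_coeff k)"

lemma gap_bound_in_unit_interval:
  assumes "m \<le> n" shows "0 \<le> gap_bound l m" "gap_bound l m \<le> 1"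
  using assms max_corr_eq_corr_coeff by (auto simp: gap_bound_def intro!: prod_nonneg prod_le_1)

text \<open>The quadratic form of the Gibbs sampler on \<open>A\<close> with block size \<open>l\<close>.  The mean of \<open>f\<close> is not
  assumed to vanish, since in the induction the statement for \<open>A - {i}\<close> is integrated over
  conditioning points, at which the conditional means differ.\<close>

lemma block_bound:
  fixes f :: "(nat \<Rightarrow> 'a) \<Rightarrow> real"
  assumes l: "1 \<le> l" and lm: "l \<le> m"
    and A: "A \<subseteq> {1..n}" "card A = m" and x: "x \<in> space S" "0 < mass A x"
    and f: "f \<in> borel_measurable S" and f2: "integrable (resample A x) (\<lambda>x. (f x)\<^sup>2)"
  shows "(\<Sum>\<Gamma> | \<Gamma> \<subseteq> A \<and> card \<Gamma> = l. LINT x'|resample A x. (kernel_op (resample \<Gamma>) f x')\<^sup>2) / (m choose l) \<le>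
    (1 - gap_bound l m) * (LINT x'|resample A x. (f x')\<^sup>2) + gap_bound l m * (kernel_op (resample A) f x)\<^sup>2"
  using lm A x f2
proof (induction m arbitrary: A x rule: dec_induct)
  case base
  have fin: "finite A" and ne: "A \<noteq> {}" using base l by (auto intro: finite_subset)
  have "{\<Gamma>. \<Gamma> \<subseteq> A \<and> card \<Gamma> = l} = {A}"
    using base(2) card_subset_eq[OF fin] by auto
  moreover have "(LINT x'|resample A x. (kernel_op (resample A) f x')\<^sup>2) = (kernel_op (resample A) f x)\<^sup>2"
  proof -
    interpret R: resampling "resample A x" "resample A"
      by (rule resampling_resample[OF base(1) ne order_refl ne base(3,4)])
    have fR: "f \<in> borel_measurable (resample A x)" using f by (simp add: measurable_resample_eq)
    have "AE x' in resample A x. (kernel_op (resample A) f x')\<^sup>2 = (kernel_op (resample A) f x)\<^sup>2"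
      using R.idempotent[OF fR, of x] base(3) by auto
    then have "(LINT x'|resample A x. (kernel_op (resample A) f x')\<^sup>2) =
        (LINT x'|resample A x. (kernel_op (resample A) f x)\<^sup>2)"
      using R.measurable_kernel_op[OF fR] by (intro integral_cong_AE) auto
    then show ?thesis by (simp add: R.prob_space[unfolded space_resample])
  qed
  ultimately show ?case by (simp add: gap_bound_def)
next
  case (step m)
  have fin: "finite A" and ne: "A \<noteq> {}" and card: "card A = Suc m" using step.prems by (auto intro: finite_subset)
  have mn: "Suc m \<le> n" using card_mono[OF _ step.prems(1)] card by simp
  have m: "1 \<le> m" using l step.hyps by simp
  note A = step.prems(1) and x = step.prems(3,4) and f2 = step.prems(5)
  interpret prob_space "resample A x" by (rule prob_resample[OF A ne x(1)])
  have fR: "f \<in> borel_measurable (resample A x)" using f by (simp add: measurable_resample_eq)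
  define h where "h = (\<lambda>\<Gamma>. LINT x'|resample A x. (kernel_op (resample \<Gamma>) f x')\<^sup>2)"
  define F where "F = (LINT x'|resample A x. (f x')\<^sup>2)"
  define e where "e = (kernel_op (resample A) f x)\<^sup>2"
  have G: "\<Gamma> \<noteq> {}" if "card \<Gamma> = l" for \<Gamma> :: "nat set" using l that by auto
  \<comment> \<open>The induction hypothesis for \<open>A - {i}\<close>, integrated over the law of the remaining coordinates.\<close>
  have one: "(\<Sum>\<Gamma> | \<Gamma> \<subseteq> A - {i} \<and> card \<Gamma> = l. h \<Gamma>) / (m choose l) \<le> (1 - gap_bound l m) * F + gap_bound l m * h (A - {i})"
    if i: "i \<in> A" for i
  proof -
    have B: "A - {i} \<subseteq> A" "A - {i} \<subseteq> {1..n}" "card (A - {i}) = m" using i A fin card by auto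
    have B_ne: "A - {i} \<noteq> {}" using B(3) m by (metis card.empty not_one_le_zero)
    interpret R: resampling "resample A x" "resample (A - {i})"
      by (rule resampling_resample[OF A ne B(1) B_ne x])
    let ?T = "{\<Gamma>. \<Gamma> \<subseteq> A - {i} \<and> card \<Gamma> = l}"
    let ?q = "\<lambda>\<Gamma> x. (kernel_op (resample \<Gamma>) f x)\<^sup>2"
    have q: "integrable (resample A x) (?q \<Gamma>)" if "\<Gamma> \<in> ?T" for \<Gamma>
      using that resampling_resample[OF A ne _ G x, of \<Gamma>]
      by (intro resampling.square_integrable_kernel_op fR f2) auto
    have Rq: "integrable (resample A x) (kernel_op (resample (A - {i})) (?q \<Gamma>))"
      "(LINT x'|resample A x. kernel_op (resample (A - {i})) (?q \<Gamma>) x') = h \<Gamma>" if "\<Gamma> \<in> ?T" for \<Gamma>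
      using R.integral_kernel_op[OF q[OF that]] by (simp_all add: h_def)
    have RF: "integrable (resample A x) (kernel_op (resample (A - {i})) (\<lambda>x. (f x)\<^sup>2))"
      "(LINT x'|resample A x. kernel_op (resample (A - {i})) (\<lambda>x. (f x)\<^sup>2) x') = F"
      using R.integral_kernel_op[OF f2] by (simp_all add: F_def)
    have Rf: "integrable (resample A x) (?q (A - {i}))"
      by (rule R.square_integrable_kernel_op[OF fR f2])
    have "(\<Sum>\<Gamma>\<in>?T. h \<Gamma>) / (m choose l) =
        (LINT x'|resample A x. (\<Sum>\<Gamma>\<in>?T. kernel_op (resample (A - {i})) (?q \<Gamma>) x') / (m choose l))"
      using Rq by (simp add: Bochner_Integration.integral_sum)
    also have "\<dots> \<le> (LINT x'|resample A x. (1 - gap_bound l m) * kernel_op (resample (A - {i})) (\<lambda>x. (f x)\<^sup>2) x'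
        + gap_bound l m * ?q (A - {i}) x')"
    proof (rule integral_mono_AE)
      show "AE x' in resample A x. (\<Sum>\<Gamma>\<in>?T. kernel_op (resample (A - {i})) (?q \<Gamma>) x') / (m choose l) \<le>
        (1 - gap_bound l m) * kernel_op (resample (A - {i})) (\<lambda>x. (f x)\<^sup>2) x' + gap_bound l m * ?q (A - {i}) x'"
        using AE_mass_pos[OF A ne B(1) x] R.AE_integrable_kernel[OF f2] AE_space
      proof eventually_elim
        case (elim x')
        then have "x' \<in> space S" by simp
        from step.IH[OF B(2,3) this elim(1,2)] show ?case by (simp add: kernel_op_def)
      qed
    qed (intro integrable_divide Bochner_Integration.integrable_sum Bochner_Integration.integrable_add
        integrable_mult_right Rq RF Rf; assumption)+
    also have "\<dots> = (1 - gap_bound l m) * F + gap_bound l m * h (A - {i})"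
      using RF Rf by (simp add: h_def)
    finally show ?thesis .
  qed
  have "(Suc m - l) * (Suc m choose l) = Suc m * (m choose l)"
    using binomial_absorb_comp[of "Suc m" l] by simp
  then have "real (Suc m - l) * real (Suc m choose l) = real (Suc m) * real (m choose l)"
    unfolding of_nat_mult[symmetric] by (simp only:)
  moreover have "real (m choose l) \<noteq> 0" "real (Suc m choose l) \<noteq> 0" "real (Suc m) \<noteq> 0"
    using step.hyps by (simp_all add: binomial_eq_0_iff)
  ultimately have bin: "real (Suc m - l) / (real (m choose l) * Suc m) = 1 / (Suc m choose l)"
    by (simp only: frac_eq_eq mult_eq_0_iff simp_thms) (simp only: mult_ac mult_1)
  have "(\<Sum>\<Gamma> | \<Gamma> \<subseteq> A \<and> card \<Gamma> = l. h \<Gamma>) / (Suc m choose l) =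
      (real (Suc m - l) * (\<Sum>\<Gamma> | \<Gamma> \<subseteq> A \<and> card \<Gamma> = l. h \<Gamma>)) / (real (m choose l) * Suc m)"
    using bin by (metis (no_types, lifting) mult.commute mult.left_neutral times_divide_eq_left)
  also have "\<dots> = (\<Sum>i\<in>A. (\<Sum>\<Gamma> | \<Gamma> \<subseteq> A - {i} \<and> card \<Gamma> = l. h \<Gamma>) / (m choose l)) / Suc m"
    using sum_subsets_remove[OF fin, of h l] card by (simp add: sum_divide_distrib[symmetric])
  also have "\<dots> \<le> (\<Sum>i\<in>A. (1 - gap_bound l m) * F + gap_bound l m * h (A - {i})) / Suc m"
    by (intro divide_right_mono sum_mono one) auto
  also have "\<dots> = (1 - gap_bound l m) * F + gap_bound l m * ((\<Sum>i\<in>A. h (A - {i})) / card A)"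
    by (simp add: sum.distrib card add_divide_distrib sum_distrib_left[symmetric])
  also have "(\<Sum>i\<in>A. h (A - {i})) / card A \<le> corr_coeff (card A) * F + (1 - corr_coeff (card A)) * e"
    unfolding h_def F_def e_def
    using one_coordinate_step[OF A _ x f f2] card m by simp
  also have "(1 - gap_bound l m) * F + gap_bound l m * (corr_coeff (card A) * F + (1 - corr_coeff (card A)) * e) = (1 - gap_bound l (Suc m)) * F + gap_bound l (Suc m) * e"
    using step.hyps by (simp add: gap_bound_def card prod.nat_ivl_Suc' algebra_simps)
  finally show ?case
    using gap_bound_in_unit_interval(1)[of m l] mn by (simp add: h_def F_def e_def mult_left_mono)
qed

section \<open>Spectral gaps of the Gibbs samplers\<close>

text \<open>Integrability is needed, as the integral of the mixture would otherwise be \<open>0\<close> by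
  convention.\<close>

lemma kernel_op_gibbs:
  fixes f :: "(nat \<Rightarrow> 'a) \<Rightarrow> real"
  assumes A: "A \<subseteq> {1..n}" and l: "1 \<le> l" "l \<le> card A" and x: "x \<in> space S"
    and f: "f \<in> borel_measurable (Pi\<^sub>M A M)" and z: "z \<in> space (Pi\<^sub>M A M)"
    and int: "\<And>\<Gamma>. \<Gamma> \<subseteq> A \<Longrightarrow> card \<Gamma> = l \<Longrightarrow> integrable (resample \<Gamma> (upd A z x)) (\<lambda>x'. f (restrict x' A))"
  shows "kernel_op (gibbs_kernel n M c ({1..n} - A) (restrict x ({1..n} - A)) l) f z =
    (\<Sum>\<Gamma> | \<Gamma> \<subseteq> A \<and> card \<Gamma> = l. kernel_op (resample \<Gamma>) (\<lambda>x'. f (restrict x' A)) (upd A z x)) / (card A choose l)"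
proof -
  have fin: "finite A" using A by (auto intro: finite_subset)
  let ?T = "{\<Gamma>. \<Gamma> \<subseteq> A \<and> card \<Gamma> = l}"
  define x' where "x' = upd A z x"
  have x': "x' \<in> space S" unfolding x'_def by (rule space_upd[OF A z x])
  define N where "N = (\<lambda>\<Gamma>. distr (cond_dist M c \<Gamma> ({1..n} - \<Gamma>) (restrict x' ({1..n} - \<Gamma>))) (Pi\<^sub>M A M)
      (\<lambda>w. restrict (merge \<Gamma> ({1..n} - \<Gamma>) (w, x')) A))"
  have T: "finite ?T" "?T \<noteq> {}"
    using fin obtain_subset_with_card_n[OF l(2)] by (auto intro: finite_subset[of _ "Pow A"])
  have mr: "(\<lambda>x. restrict x A) \<in> S \<rightarrow>\<^sub>M Pi\<^sub>M A M" by (rule measurable_restrict_subset[OF A])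
  have N: "N \<Gamma> = distr (resample \<Gamma> x') (Pi\<^sub>M A M) (\<lambda>x. restrict x A)" if "\<Gamma> \<in> ?T" for \<Gamma>
    unfolding N_def resample_def
    using that A by (subst distr_distr[OF mr measurable_upd_const[OF _ x']]) (auto simp: comp_def)
  have mr': "(\<lambda>x. restrict x A) \<in> resample \<Gamma> x' \<rightarrow>\<^sub>M Pi\<^sub>M A M" for \<Gamma>
    using mr by (simp add: measurable_resample_eq)
  have NP: "prob_space (N \<Gamma>)" if "\<Gamma> \<in> ?T" for \<Gamma>
  proof -
    have "\<Gamma> \<subseteq> {1..n}" "\<Gamma> \<noteq> {}" using that A l by auto
    then show ?thesis
      unfolding N[OF that] by (intro prob_space.prob_space_distr prob_resample x' mr')
  qed
  have "kernel_op (gibbs_kernel n M c ({1..n} - A) (restrict x ({1..n} - A)) l) f z =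
      (LINT u|bind (uniform_count_measure ?T) N. f u)"
    unfolding kernel_op_def gibbs_kernel_def Let_def diff_diff_E[OF A] merge_swap merge_restrict
      N_def x'_def ..
  also have "\<dots> = (\<Sum>\<Gamma>\<in>?T. LINT u|N \<Gamma>. f u) / card ?T"
  proof (rule integral_bind_uniform_count_measure[OF T NP _ f])
    show "sets (N \<Gamma>) = sets (Pi\<^sub>M A M)" for \<Gamma> by (simp add: N_def)
    show "integrable (N \<Gamma>) f" if "\<Gamma> \<in> ?T" for \<Gamma>
      unfolding N[OF that] integrable_distr_eq[OF mr' f] unfolding x'_def using int that by blast
  qed
  also have "(\<Sum>\<Gamma>\<in>?T. LINT u|N \<Gamma>. f u) = (\<Sum>\<Gamma>\<in>?T. kernel_op (resample \<Gamma>) (\<lambda>x'. f (restrict x' A)) x')"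
    by (intro sum.cong refl) (simp only: N integral_distr[OF mr' f] kernel_op_def)
  finally show ?thesis unfolding n_subsets[OF fin] x'_def .
qed

text \<open>A function \<open>f\<close> of the coordinates in \<open>A\<close> is viewed as the function \<open>F\<close> on the full space; the
  norms of \<open>f\<close> and \<open>F\<close> agree, and the image of \<open>f\<close> under the Gibbs sampler corresponds to the
  average \<open>G\<close> of projections of \<open>F\<close>.\<close>

lemma gibbs_gap_ge:
  assumes A: "A \<subseteq> {1..n}" and l: "1 \<le> l" "l \<le> card A" and x: "x \<in> space S" "0 < mass A x"
  shows "ereal (gap_bound l (card A)) \<le> gibbs_gap n M c ({1..n} - A) (restrict x ({1..n} - A)) l"
proof -
  have fin: "finite A" and ne: "A \<noteq> {}" using A l by (auto intro: finite_subset)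
  have card: "card A \<le> n" using card_mono[OF _ A] by simp
  define \<nu> where "\<nu> = cond_dist M c A ({1..n} - A) (restrict x ({1..n} - A))"
  define K where "K = gibbs_kernel n M c ({1..n} - A) (restrict x ({1..n} - A)) l"
  define r where "r = 1 - gap_bound l (card A)"
  have r: "0 \<le> r" using gap_bound_in_unit_interval(2)[OF card] by (simp add: r_def)
  have r': "1 - r = gap_bound l (card A)" by (simp add: r_def)
  let ?T = "{\<Gamma>. \<Gamma> \<subseteq> A \<and> card \<Gamma> = l}"
  have T: "finite ?T" using fin by (auto intro: finite_subset[of _ "Pow A"])
  have cardT: "card ?T = (card A choose l)" by (rule n_subsets[OF fin])
  have P: "prob_space (resample A x)" by (rule prob_resample[OF A ne x(1)])
  have res: "resampling (resample A x) (resample \<Gamma>)" if "\<Gamma> \<in> ?T" for \<Gamma>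
    using that l by (intro resampling_resample A ne x) auto
  have \<nu>_meas: "measurable \<nu> = measurable (Pi\<^sub>M A M)" unfolding \<nu>_def by (rule measurable_cond_dist_eq)
  have contraction: "norm_L2 \<nu> (kernel_op K f) \<le> r * norm_L2 \<nu> f" if fL: "f \<in> L20 \<nu>" for f
  proof -
    have f: "f \<in> borel_measurable (Pi\<^sub>M A M)" and f2: "integrable \<nu> (\<lambda>z. (f z)\<^sup>2)"
      and f0: "(LINT z|\<nu>. f z) = 0"
      using fL by (auto simp: L20_def \<nu>_meas)
    define F where "F = (\<lambda>x'. f (restrict x' A))"
    have F: "F \<in> borel_measurable S"
      unfolding F_def by (rule measurable_compose[OF measurable_restrict_subset[OF A] f])
    have F_upd: "F (upd A z x) = f z" if "z \<in> space \<nu>" for z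
    proof -
      have "restrict (upd A z x) A = z"
        using that by (auto simp: \<nu>_def fun_eq_iff merge_def space_PiM PiE_def extensional_def)
      then show ?thesis by (simp only: F_def)
    qed
    have F2: "integrable (resample A x) (\<lambda>x'. (F x')\<^sup>2)"
      "(LINT x'|resample A x. (F x')\<^sup>2) = (LINT z|\<nu>. (f z)\<^sup>2)"
      "(LINT x'|resample A x. F x') = 0"
      using integral_resample[OF A x(1), of "\<lambda>x. (F x)\<^sup>2"] integral_resample[OF A x(1), of F] F f2 f0
      by (simp_all add: F_upd \<nu>_def[symmetric] cong: Bochner_Integration.integral_cong Bochner_Integration.integrable_cong)
    have FL: "F \<in> L20 (resample A x)"
      using F F2 by (simp add: L20_def measurable_resample_eq)
    define G where "G = (\<lambda>x'. (\<Sum>\<Gamma>\<in>?T. kernel_op (resample \<Gamma>) F x') / card ?T)"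
    have G: "G \<in> borel_measurable S"
    proof -
      have "kernel_op (resample \<Gamma>) F \<in> borel_measurable S" if "\<Gamma> \<in> ?T" for \<Gamma>
        using that A l F by (intro measurable_kernel_op_resample) auto
      then show ?thesis unfolding G_def by simp
    qed
    have G_le: "(LINT x'|resample A x. (G x')\<^sup>2) \<le> r\<^sup>2 * (LINT x'|resample A x. (F x')\<^sup>2)"
      unfolding G_def
    proof (rule average_kernel_op_sq_le[OF T P res _ r FL])
      fix h :: "(nat \<Rightarrow> 'a) \<Rightarrow> real" assume hL: "h \<in> L20 (resample A x)"
      then have h: "h \<in> borel_measurable S" "integrable (resample A x) (\<lambda>x. (h x)\<^sup>2)"
        "kernel_op (resample A) h x = 0"
        by (auto simp: L20_def measurable_resample_eq kernel_op_def)
      show "(\<Sum>\<Gamma>\<in>?T. LINT x'|resample A x. (kernel_op (resample \<Gamma>) h x')\<^sup>2) / card ?T \<le>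
          r * (LINT x'|resample A x. (h x')\<^sup>2)"
        using block_bound[OF l A refl x h(1,2)] by (simp add: h(3) cardT r_def)
    qed
    have AE_G: "AE z in \<nu>. kernel_op K f z = G (upd A z x)"
    proof -
      have F1: "integrable (resample A x) F"
        using F by (intro prob_space.square_integrable_imp_integrable[OF P _ F2(1)]) (simp add: measurable_resample_eq)
      have "AE x' in resample A x. \<forall>\<Gamma>\<in>?T. integrable (resample \<Gamma> x') F"
        using resampling.AE_integrable_kernel[OF res F1] T by (intro AE_finite_allI) auto
      then have "AE z in \<nu>. \<forall>\<Gamma>\<in>?T. integrable (resample \<Gamma> (upd A z x)) F"
        unfolding resample_def[of A x] \<nu>_def by (rule AE_distrD[OF measurable_upd_const[OF A x(1)]])
      with AE_space show ?thesis
      proof eventually_elim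
        case (elim z)
        then have "z \<in> space (Pi\<^sub>M A M)" by (simp add: \<nu>_def)
        from kernel_op_gibbs[OF A l x(1) f this] elim(2) show ?case
          unfolding K_def F_def[symmetric] G_def cardT by auto
      qed
    qed
    have "(LINT z|\<nu>. (kernel_op K f z)\<^sup>2) \<le> r\<^sup>2 * (LINT z|\<nu>. (f z)\<^sup>2)"
    proof (cases "(\<lambda>z. (kernel_op K f z)\<^sup>2) \<in> borel_measurable \<nu>")
      case True
      have "(\<lambda>z. G (upd A z x)) \<in> borel_measurable \<nu>"
        unfolding \<nu>_def by (rule measurable_compose[OF measurable_upd_const[OF A x(1)] G])
      then have "(LINT z|\<nu>. (kernel_op K f z)\<^sup>2) = (LINT z|\<nu>. (G (upd A z x))\<^sup>2)"
        using True AE_G by (intro integral_cong_AE) auto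
      also have "\<dots> = (LINT x'|resample A x. (G x')\<^sup>2)"
        using integral_resample(1)[OF A x(1), of "\<lambda>x. (G x)\<^sup>2"] G by (simp add: \<nu>_def)
      also have "\<dots> \<le> r\<^sup>2 * (LINT z|\<nu>. (f z)\<^sup>2)" using G_le F2(2) by simp
      finally show ?thesis .
    next
      case False
      \<comment> \<open>A nonmeasurable square has integral \<open>0\<close>.\<close>
      then have "\<not> integrable \<nu> (\<lambda>z. (kernel_op K f z)\<^sup>2)" by (auto dest: borel_measurable_integrable)
      then have "(LINT z|\<nu>. (kernel_op K f z)\<^sup>2) = 0" by (rule not_integrable_integral_eq)
      then show ?thesis by simp
    qed
    then have "sqrt (LINT z|\<nu>. (kernel_op K f z)\<^sup>2) \<le> sqrt (r\<^sup>2 * (LINT z|\<nu>. (f z)\<^sup>2))"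
      by (rule real_sqrt_le_mono)
    then show ?thesis using r by (simp add: norm_L2_def real_sqrt_mult)
  qed
  have "kernel_norm \<nu> K \<le> ereal r"
    unfolding kernel_norm_def
  proof (rule Sup_least, safe)
    fix f assume f: "f \<in> L20 \<nu>" "norm_L2 \<nu> f \<noteq> 0"
    then have "0 < norm_L2 \<nu> f" by (simp add: norm_L2_def less_le)
    then show "ereal (norm_L2 \<nu> (kernel_op K f) / norm_L2 \<nu> f) \<le> ereal r"
      using contraction[OF f(1)] by (simp add: pos_divide_le_eq)
  qed (use r in simp)
  then have "1 - ereal r \<le> 1 - kernel_norm \<nu> K" by (intro ereal_minus_mono) auto
  then show ?thesis
    unfolding gibbs_gap_def spectral_gap_def diff_diff_E[OF A] \<nu>_def[symmetric] K_def[symmetric]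
    by (simp add: one_ereal_def r')
qed

lemma Gap_ge:
  assumes l: "1 \<le> l" "l \<le> m" and m: "m \<le> n"
  shows "ereal (gap_bound l m) \<le> Gap n M p c m l"
proof -
  note fin = finite_nonempty_subsets[of "n - m"]
  have "ereal (gap_bound l m) \<le> gibbs_gap n M c \<Lambda> y l"
    if L: "\<Lambda> \<subseteq> {1..n}" "card \<Lambda> = n - m" and y: "y \<in> space (Pi\<^sub>M \<Lambda> M)" "0 < marginal n M p \<Lambda> y" for \<Lambda> y
  proof -
    obtain x where x: "x \<in> space S" "restrict x \<Lambda> = y" "0 < mass ({1..n} - \<Lambda>) x"
      using mass_complement[OF L(1) y] .
    have "card ({1..n} - \<Lambda>) = m"
      using L m finite_subset[OF L(1)] by (simp add: card_Diff_subset)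
    then show ?thesis
      using gibbs_gap_ge[of "{1..n} - \<Lambda>" l x] l x by (simp add: diff_diff_E[OF L(1)] del: restrict_apply)
  qed
  then show ?thesis
    unfolding Gap_def using fin by (auto intro!: INF_greatest)
qed

end

theorem corollary3:
  fixes n :: nat
    and M :: "nat \<Rightarrow> 'a measure"
    and P :: "'w measure"
    and X :: "'w \<Rightarrow> nat \<Rightarrow> 'a"
    and p :: "(nat \<Rightarrow> 'a) \<Rightarrow> real"
    and c :: "nat set \<Rightarrow> nat set \<Rightarrow> (nat \<Rightarrow> 'a) \<Rightarrow> (nat \<Rightarrow> 'a) \<Rightarrow> real"
  assumes "2 \<le> n"
    and "\<And>i. i \<in> {1..n} \<Longrightarrow> sigma_finite_measure (M i)"
    and "\<And>i x. i \<in> {1..n} \<Longrightarrow> x \<in> space (M i) \<Longrightarrow> {x} \<in> sets (M i)"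
    and "prob_space P"
    and "p \<in> borel_measurable (Pi\<^sub>M {1..n} M)"
    and "\<And>x. x \<in> space (Pi\<^sub>M {1..n} M) \<Longrightarrow> 0 \<le> p x"
    and "distributed P (Pi\<^sub>M {1..n} M) X (\<lambda>x. ennreal (p x))"
    and "cond_densities n M p c"
  shows "(\<forall>m\<in>{2..n}. Gap n M p c m (m - 1) \<ge> 1 - max_corr n M p c m) \<and>
         (\<forall>l\<in>{1..n - 1}. Gap n M p c n l \<ge> (\<Prod>m = l + 1..n. 1 - max_corr n M p c m))"
proof -
  interpret P: prob_space P by fact
  interpret conditional_model n M p c
  proof (rule conditional_model.intro)
    have "prob_space (distr P (Pi\<^sub>M {1..n} M) X)"
      using assms(7) by (intro P.prob_space_distr) (simp add: distributed_def)
    then show "prob_space (density (Pi\<^sub>M {1..n} M) (\<lambda>x. ennreal (p x)))"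
      using assms(7) by (simp add: distributed_def)
  qed (use assms in auto)
  have one_minus: "1 - max_corr n M p c m = ereal (1 - corr_coeff m)" if "1 \<le> m" "m \<le> n" for m
    using max_corr_eq_corr_coeff(1)[OF that] by (simp add: one_ereal_def)
  have prod: "(\<Prod>k = l + 1..m. 1 - max_corr n M p c k) = ereal (gap_bound l m)" if "m \<le> n" for l m
    unfolding gap_bound_def prod_ereal[symmetric] using that by (intro prod.cong refl one_minus) auto
  show ?thesis
  proof (intro conjI ballI)
    fix m assume m: "m \<in> {2..n}"
    then have "m - 1 + 1 = m" by simp
    then have "1 - max_corr n M p c m = ereal (gap_bound (m - 1) m)"
      using prod[of m "m - 1"] m by simp
    then show "Gap n M p c m (m - 1) \<ge> 1 - max_corr n M p c m"
      using Gap_ge[of "m - 1" m] m by (simp add: le_diff_conv2)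
  next
    fix l assume "l \<in> {1..n - 1}"
    then have "1 \<le> l" "l \<le> n" by auto
    then show "Gap n M p c n l \<ge> (\<Prod>m = l + 1..n. 1 - max_corr n M p c m)"
      using Gap_ge[of l n] prod[of n l] by simp
  qed
qed
end
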